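(* Let $F$ be a smooth vector field on the closed unit ball of $\mathfrak g_0=\mathbb R^n$. (1) If $F$ has escaping points in the open unit ball $B$, then the $L$-$F$ system on $SM$ is semi-integrable. (2) If the set of escaping points of $F$ is dense in the unit ball, then the $L$-$F$ system on $SM$ is integrable.
   Context: Let $\mathfrak g_0=\mathbb R^n$ with its Euclidean scalar product and let $L:\mathfrak g_0\to\mathfrak g_0$ be an arbitrary linear operator. Let $G=\mathbb R^n\times\mathbb R$ be the Lie group with coordinates $(w,u)$ and multiplication $(w,u)(w',u')=(w+e^{uL}w',u+u')$ (semi-direct product of the normal abelian subgroup $G_0=\{u=0\}\cong\mathbb R^n$ and $G_1=\{w=0\}\cong\mathbb R$). Its Lie algebra is $\mathfrak g=\mathfrak g_0\oplus\mathbb R b$ with $\mathfrak g_0$ an abelian ideal and $\mathrm{ad}_b|_{\mathfrak g_0}=L$; it carries the scalar product extending that of $\mathfrak g_0$ with $b$ a unit vector orthogonal to $\mathfrak g_0$, and $G$ carries the corresponding left-invariant Riemannian metric. Elements of $\mathfrak g$ are written $(\xi,\eta)=\xi+\eta b$, and $TG$ is identified with $G\times\mathfrak g$ by left translations, with coordinates $(w,u;\xi,\eta)$. Let $\Gamma_0\subset G_0$ be a lattice of rank $n$, and $M=\Gamma_0\backslash G\cong(\Gamma_0\backslash\mathbb R^n)\times\mathbb R$, so that $TM=M\times\mathfrak g$ and the unit sphere bundle is $SM=M\times\{\xi^2+\eta^2=1\}$. For a smooth vector field $F$ on the closed unit ball of $\mathfrak g_0$, the $L$-$F$ system on $SM$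 is the flow of $$\frac{d\xi}{dt}=\eta F(\xi),\quad \frac{d\eta}{dt}=-\langle F(\xi),\xi\rangle,\quad \frac{dw}{dt}=e^{uL}\xi,\quad \frac{du}{dt}=\eta .$$ Let $S=\partial B$ be the unit sphere of $\mathfrak g_0$. A point $\zeta_0\in B$ is escaping for $F$ if the integral curve $\zeta(s)$ of $F$ ($d\zeta/ds=F(\zeta)$) with $\zeta(0)=\zeta_0$ is defined on a finite closed interval $[s_-,s_+]\ni 0$, $\zeta(s)\in B$ for $s\in(s_-,s_+)$, $\zeta(s_\pm)\in S$, and $\langle F(\zeta(s_-)),\zeta(s_-)\rangle<0$, $\langle F(\zeta(s_+)),\zeta(s_+)\rangle>0$. A dynamical system is semi-integrable if a (nonempty) open subset $U$ of the phase space is filled with (is a union of) invariant tori carrying quasi-periodic motions; it is integrable if $U$ can be taken also dense in the phase space. A motion on a torus is quasi-periodic if the flow on the torus is conjugate to a linear flow $\theta\mapsto\theta+t\omega$. *)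

theory Defs
  imports "HOL-Analysis.Analysis"
begin

section \<open>Smooth vector fields on closed sets\<close>

text \<open>
  On an open subset of a finite-dimensional space this is the usual class \<open>C\<^sup>k\<close>: the directional
  derivatives in all directions are \<open>C\<^sup>k\<^sup>-\<^sup>1\<close>.
\<close>

fun C_k_on :: "nat \<Rightarrow> 'a::real_normed_vector set \<Rightarrow> ('a \<Rightarrow> 'b::real_normed_vector) \<Rightarrow> bool" where
  "C_k_on 0 S f \<longleftrightarrow> continuous_on S f"
| "C_k_on (Suc k) S f \<longleftrightarrow>
     (\<forall>x\<in>S. f differentiable (at x)) \<and>
     (\<forall>v. C_k_on k S (\<lambda>x. frechet_derivative f (at x) v))"

text \<open>Smoothness on an arbitrary set means having a smooth extension to an open neighbourhood.\<close>

definition smooth_on :: "'a::real_normed_vector set \<Rightarrow> ('a \<Rightarrow> 'b::real_normed_vector) \<Rightarrow> bool" where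
  "smooth_on S f \<longleftrightarrow>
     (\<exists>W f'. open W \<and> S \<subseteq> W \<and> (\<forall>x\<in>S. f' x = f x) \<and> (\<forall>k. C_k_on k W f'))"


section \<open>The group \<open>G\<close> and the quotient \<open>M\<close> of \<open>G\<close> by \<open>\<Gamma>\<^sub>0\<close>\<close>

text \<open>\<open>exp_op L u\<close> is the operator \<open>e\<^sup>u\<^sup>L\<close>.\<close>

definition exp_op :: "('a \<Rightarrow> 'a) \<Rightarrow> real \<Rightarrow> 'a \<Rightarrow> 'a::real_normed_vector" where
  "exp_op L u w = (\<Sum>k. (u ^ k / fact k) *\<^sub>R (L ^^ k) w)"

fun G_mult :: "('a \<Rightarrow> 'a) \<Rightarrow> 'a \<times> real \<Rightarrow> 'a \<times> real \<Rightarrow> 'a::real_normed_vector \<times> real" where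
  "G_mult L (w, u) (w', u') = (w + exp_op L u w', u + u')"

definition full_rank_lattice :: "'a::real_vector set \<Rightarrow> bool" where
  "full_rank_lattice \<Gamma> \<longleftrightarrow>
     (\<exists>B. finite B \<and> independent B \<and> span B = UNIV \<and>
          \<Gamma> = {\<Sum>b\<in>B. of_int (c b) *\<^sub>R b | c :: 'a \<Rightarrow> int. True})"

text \<open>
  Points of \<open>M\<close> are the cosets \<open>\<Gamma>\<^sub>0 g\<close>, where \<open>\<gamma> \<in> \<Gamma>\<^sub>0\<close> is the element \<open>(\<gamma>, 0)\<close> of \<open>G\<close>;
  \<open>M\<close> carries the quotient topology.
\<close>

definition coset_M :: "('a \<Rightarrow> 'a) \<Rightarrow> 'a set \<Rightarrow> 'a \<times> real \<Rightarrow> ('a::real_normed_vector \<times> real) set" where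
  "coset_M L \<Gamma> g = (\<lambda>\<gamma>. G_mult L (\<gamma>, 0) g) ` \<Gamma>"

definition M_topology :: "('a \<Rightarrow> 'a) \<Rightarrow> 'a set \<Rightarrow> ('a::real_normed_vector \<times> real) set topology" where
  "M_topology L \<Gamma> = topology (\<lambda>U. U \<subseteq> range (coset_M L \<Gamma>) \<and> open (coset_M L \<Gamma> -` U))"

lemma openin_M_topology:
  "openin (M_topology L \<Gamma>) U \<longleftrightarrow> U \<subseteq> range (coset_M L \<Gamma>) \<and> open (coset_M L \<Gamma> -` U)"
proof -
  have "istopology (\<lambda>U. U \<subseteq> range (coset_M L \<Gamma>) \<and> open (coset_M L \<Gamma> -` U))"
    unfolding istopology_def by (auto simp: vimage_Union intro!: open_Int open_UN)
  then show ?thesis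
    by (simp add: M_topology_def)
qed

lemma quotient_map_coset_M: "quotient_map euclidean (M_topology L \<Gamma>) (coset_M L \<Gamma>)"
proof -
  have "openin (M_topology L \<Gamma>) (range (coset_M L \<Gamma>))"
    by (simp add: openin_M_topology vimage_def)
  then have "topspace (M_topology L \<Gamma>) = range (coset_M L \<Gamma>)"
    by (metis openin_M_topology openin_subset openin_topspace subset_antisym)
  then show ?thesis
    by (auto simp: quotient_map_def openin_M_topology vimage_def)
qed

text \<open>
  The Lie algebra \<open>\<gg> = \<gg>\<^sub>0 \<oplus> \<real>b\<close> is the Euclidean space of pairs \<open>(\<xi>, \<eta>)\<close> with the product inner
  product, so its unit sphere \<open>\<xi>\<^sup>2 + \<eta>\<^sup>2 = 1\<close> is \<^term>\<open>sphere 0 1\<close>.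
\<close>

definition SM_topology ::
  "('a \<Rightarrow> 'a) \<Rightarrow> 'a set \<Rightarrow> (('a::real_normed_vector \<times> real) set \<times> ('a \<times> real)) topology" where
  "SM_topology L \<Gamma> = prod_topology (M_topology L \<Gamma>) (top_of_set (sphere 0 1))"

definition proj_TM ::
  "('a \<Rightarrow> 'a) \<Rightarrow> 'a set \<Rightarrow> ('a::real_normed_vector \<times> real) \<times> ('a \<times> real)
    \<Rightarrow> ('a \<times> real) set \<times> ('a \<times> real)" where
  "proj_TM L \<Gamma> = map_prod (coset_M L \<Gamma>) id"


section \<open>The \<open>L\<close>-\<open>F\<close> system\<close>

fun LF_field ::
  "('a \<Rightarrow> 'a) \<Rightarrow> ('a \<Rightarrow> 'a) \<Rightarrow> ('a::real_inner \<times> real) \<times> ('a \<times> real)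
    \<Rightarrow> ('a \<times> real) \<times> ('a \<times> real)" where
  "LF_field L F ((w, u), (\<xi>, \<eta>)) = ((exp_op L u \<xi>, \<eta>), (\<eta> *\<^sub>R F \<xi>, - (F \<xi> \<bullet> \<xi>)))"

text \<open>
  \<open>LF_flow L F \<Gamma> t x y\<close>: the point \<open>y\<close> of \<open>SM\<close> is reached at time \<open>t\<close> by a motion of the system
  starting at \<open>x\<close>. Motions on \<open>SM\<close> are the projections of solutions in the coordinates of
  \<open>TG = G \<times> \<gg>\<close>.
\<close>

definition LF_flow ::
  "('a \<Rightarrow> 'a) \<Rightarrow> ('a \<Rightarrow> 'a) \<Rightarrow> 'a set \<Rightarrow> real \<Rightarrow>
    ('a::real_inner \<times> real) set \<times> ('a \<times> real) \<Rightarrow> ('a \<times> real) set \<times> ('a \<times> real) \<Rightarrow> bool" where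
  "LF_flow L F \<Gamma> t x y \<longleftrightarrow>
     (\<exists>\<sigma>. (\<forall>s\<in>closed_segment 0 t.
            snd (\<sigma> s) \<in> sphere 0 1 \<and>
            (\<sigma> has_vector_derivative LF_field L F (\<sigma> s)) (at s within closed_segment 0 t)) \<and>
          proj_TM L \<Gamma> (\<sigma> 0) = x \<and> proj_TM L \<Gamma> (\<sigma> t) = y)"

definition escaping :: "('a::real_inner \<Rightarrow> 'a) \<Rightarrow> 'a \<Rightarrow> bool" where
  "escaping F \<zeta>\<^sub>0 \<longleftrightarrow> \<zeta>\<^sub>0 \<in> ball 0 1 \<and>
     (\<exists>a b \<zeta>. 0 \<in> {a..b} \<and> \<zeta> 0 = \<zeta>\<^sub>0 \<and>
        (\<forall>s\<in>{a..b}. (\<zeta> has_vector_derivative F (\<zeta> s)) (at s within {a..b})) \<and>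
        (\<forall>s\<in>{a<..<b}. \<zeta> s \<in> ball 0 1) \<and>
        \<zeta> a \<in> sphere 0 1 \<and> \<zeta> b \<in> sphere 0 1 \<and>
        F (\<zeta> a) \<bullet> \<zeta> a < 0 \<and> F (\<zeta> b) \<bullet> \<zeta> b > 0)"


section \<open>Quasi-periodic tori and integrability\<close>

definition torus :: "nat \<Rightarrow> (nat \<Rightarrow> complex) topology" where
  "torus k = product_topology (\<lambda>_. top_of_set (sphere 0 1)) {..<k}"

definition torus_angle :: "nat \<Rightarrow> (nat \<Rightarrow> real) \<Rightarrow> nat \<Rightarrow> complex" where
  "torus_angle k \<theta> = (\<lambda>i\<in>{..<k}. cis (\<theta> i))"

definition linear_flow :: "nat \<Rightarrow> (nat \<Rightarrow> real) \<Rightarrow> real \<Rightarrow> (nat \<Rightarrow> complex) \<Rightarrow> nat \<Rightarrow> complex" where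
  "linear_flow k \<omega> t z = (\<lambda>i\<in>{..<k}. cis (t * \<omega> i) * z i)"

text \<open>
  Since the dimension \<open>k\<close> of a torus is not fixed in advance, functions of the angles
  \<open>\<theta>\<^sub>0, \<dots>, \<theta>\<^sub>k\<^sub>-\<^sub>1\<close> are functions on \<^typ>\<open>nat \<Rightarrow> real\<close>, and \<open>C\<^sup>m\<close> is expressed by continuity of
  the iterated partial derivatives up to order \<open>m\<close>.
\<close>

definition partial_deriv :: "nat \<Rightarrow> ((nat \<Rightarrow> real) \<Rightarrow> 'b::real_normed_vector) \<Rightarrow> (nat \<Rightarrow> real) \<Rightarrow> 'b"
  where "partial_deriv i f \<theta> = vector_derivative (\<lambda>h. f (\<theta>(i := h))) (at (\<theta> i))"

fun C_m_angles :: "nat \<Rightarrow> nat \<Rightarrow> ((nat \<Rightarrow> real) \<Rightarrow> 'b::real_normed_vector) \<Rightarrow> bool" where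
  "C_m_angles k 0 f \<longleftrightarrow> continuous_on UNIV f"
| "C_m_angles k (Suc m) f \<longleftrightarrow> continuous_on UNIV f \<and>
     (\<forall>i<k. (\<forall>\<theta>. (\<lambda>h. f (\<theta>(i := h))) differentiable (at (\<theta> i))) \<and>
            C_m_angles k m (partial_deriv i f))"

text \<open>
  Smooth embeddings of a torus in \<open>SM\<close>. The smooth structure of \<open>SM\<close> is the one for which the
  covering \<open>G \<times> sphere 0 1 \<rightarrow> SM\<close> is a local diffeomorphism, so smoothness and the immersion property
  are expressed by a lift \<open>\<Psi>\<close> to \<open>G \<times> \<gg>\<close> of the map in the angle coordinates.
\<close>

definition smooth_torus_embedding ::
  "('a \<Rightarrow> 'a) \<Rightarrow> 'a set \<Rightarrow> nat \<Rightarrow>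
    ((nat \<Rightarrow> complex) \<Rightarrow> ('a::real_normed_vector \<times> real) set \<times> ('a \<times> real)) \<Rightarrow> bool" where
  "smooth_torus_embedding L \<Gamma> k \<Phi> \<longleftrightarrow>
     embedding_map (torus k) (SM_topology L \<Gamma>) \<Phi> \<and>
     (\<exists>\<Psi>. (\<forall>\<theta>. \<Phi> (torus_angle k \<theta>) = proj_TM L \<Gamma> (\<Psi> \<theta>)) \<and>
          (\<forall>m. C_m_angles k m \<Psi>) \<and>
          (\<forall>\<theta> c. (\<Sum>i<k. c i *\<^sub>R partial_deriv i \<Psi> \<theta>) = 0 \<longrightarrow> (\<forall>i<k. c i = 0)))"

text \<open>
  The equivalence in the last conjunct says that the motion through every point of the torus exists
  for all times, is unique, stays on the torus (invariance) and corresponds to the linear flow.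
\<close>

definition quasi_periodic_torus ::
  "('a \<Rightarrow> 'a) \<Rightarrow> ('a \<Rightarrow> 'a) \<Rightarrow> 'a set \<Rightarrow> (('a::real_inner \<times> real) set \<times> ('a \<times> real)) set \<Rightarrow> bool"
  where
  "quasi_periodic_torus L F \<Gamma> T \<longleftrightarrow>
     (\<exists>k \<Phi> \<omega>. k \<ge> 1 \<and> smooth_torus_embedding L \<Gamma> k \<Phi> \<and> T = \<Phi> ` topspace (torus k) \<and>
        (\<forall>z\<in>topspace (torus k). \<forall>t y.
            LF_flow L F \<Gamma> t (\<Phi> z) y \<longleftrightarrow> y = \<Phi> (linear_flow k \<omega> t z)))"

definition filled_with_qp_tori ::
  "('a \<Rightarrow> 'a) \<Rightarrow> ('a \<Rightarrow> 'a) \<Rightarrow> 'a set \<Rightarrow> (('a::real_inner \<times> real) set \<times> ('a \<times> real)) set \<Rightarrow> bool"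
  where
  "filled_with_qp_tori L F \<Gamma> U \<longleftrightarrow> (\<exists>\<T>. (\<forall>T\<in>\<T>. quasi_periodic_torus L F \<Gamma> T) \<and> U = \<Union>\<T>)"

definition LF_semi_integrable :: "('a \<Rightarrow> 'a) \<Rightarrow> ('a \<Rightarrow> 'a) \<Rightarrow> 'a::real_inner set \<Rightarrow> bool" where
  "LF_semi_integrable L F \<Gamma> \<longleftrightarrow>
     (\<exists>U. openin (SM_topology L \<Gamma>) U \<and> U \<noteq> {} \<and> filled_with_qp_tori L F \<Gamma> U)"

definition LF_integrable :: "('a \<Rightarrow> 'a) \<Rightarrow> ('a \<Rightarrow> 'a) \<Rightarrow> 'a::real_inner set \<Rightarrow> bool" where
  "LF_integrable L F \<Gamma> \<longleftrightarrow>
     (\<exists>U. openin (SM_topology L \<Gamma>) U \<and> U \<noteq> {} \<and> filled_with_qp_tori L F \<Gamma> U \<and>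
          SM_topology L \<Gamma> closure_of U = topspace (SM_topology L \<Gamma>))"

end

theory Submission
  imports Defs
begin

text \<open>
  The equations for \<open>(\<xi>, \<eta>)\<close> decouple from \<open>(w, u)\<close> and define a complete flow on the unit sphere,
  which is reversed by \<open>(\<xi>, \<eta>) \<mapsto> (\<xi>, - \<eta>)\<close>. A motion with \<open>\<eta> = 0\<close> at time \<open>a\<close> is therefore symmetric
  about \<open>a\<close>, and one with \<open>\<eta> = 0\<close> at two consecutive times \<open>\<alpha> < \<beta>\<close> has minimal period \<open>T = 2(\<beta> - \<alpha>)\<close>.
  Along it \<open>\<xi>\<close> runs back and forth on an integral curve of \<open>F\<close>, with speed \<open>\<eta>\<close>; for an escaping curve the
  transversality at the ends makes \<open>\<eta>\<close> reach \<open>0\<close> in finite time and change sign there. By symmetry \<open>u\<close>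
  is \<open>T\<close>-periodic too, while \<open>w\<close> is the sum of a \<open>T\<close>-periodic function and the linear drift \<open>(t / T) \<Delta>\<close>.
  So the phase along the period together with the position of \<open>w\<close> modulo the lattice, drift subtracted,
  sweeps out an invariant torus of dimension \<open>n + 1\<close> on which the flow is linear. That \<open>\<eta>\<close> takes
  the signs \<open>-, +, -\<close> at some times is an open condition on the initial point by continuous dependence,
  which makes the union of these tori open.
\<close>

section \<open>Global solutions of Lipschitz differential equations\<close>

text \<open>The proof is carried by oscillating rather than escaping points. Escaping is a condition
  on a curve of \<open>F\<close> in the ball, whereas oscillation is a property of an orbit on the
  sphere: it is invariant under time shifts and under the reversal, and its stability can be read
  off at three fixed times, without following the turning points. Escaping enters only through the
  fact that the points of the sphere above an escaping point oscillate. The field does not involve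
  \<open>w\<close>, and \<open>u\<close> and \<open>w\<close> arise from the sphere motion by two
  integrations, so the open set can be all of M times the oscillating points, and translations in
  \<open>w\<close> complete the closed curve of the phase to a torus. The drift \<Delta> need not
  lie in the lattice; its lattice coordinates become n of the n + 1 frequencies. Two obstacles shape
  the analysis. \<open>F\<close> is controlled on the closed ball only, so global existence has to
  be obtained for a modified field whose solutions are then shown to stay on the sphere. And
  \<open>LF_flow\<close> admits any lifted solution on a time segment of either orientation, so
  uniqueness is needed in that generality.\<close>

lemma gronwall_unit:
  fixes d d' :: "real \<Rightarrow> 'a::real_inner"
  assumes der: "\<And>s. s \<in> {0..1} \<Longrightarrow> (d has_vector_derivative d' s) (at s within {0..1})"
    and bound: "\<And>s. s \<in> {0..1} \<Longrightarrow> norm (d' s) \<le> K * norm (d s)"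
  shows "norm (d 1) \<le> exp K * norm (d 0)"
proof -
  \<comment> \<open>The weight turns the bound on \<open>d'\<close> into monotonicity: the
    derivative of |d|^2 is at most 2K |d|^2.\<close>
  define g where "g = (\<lambda>s. exp (- (2 * K * s)) * (d s \<bullet> d s))"
  define g' where "g' s = exp (- (2 * K * s)) * (2 * (d s \<bullet> d' s)) - 2 * K * g s" for s
  have g': "(g has_derivative (\<lambda>h. h * g' s)) (at s within {0..1})" if "s \<in> {0..1}" for s
    using der[OF that] unfolding g_def g'_def has_vector_derivative_def
    by (auto intro!: derivative_eq_intros simp: algebra_simps inner_commute)
  have g'_le: "g' s \<le> 0" if "s \<in> {0..1}" for s
  proof -
    have "d s \<bullet> d' s \<le> norm (d s) * norm (d' s)"
      by (rule norm_cauchy_schwarz)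
    also have "\<dots> \<le> norm (d s) * (K * norm (d s))"
      using bound[OF that] by (intro mult_left_mono) auto
    also have "\<dots> = K * (d s \<bullet> d s)"
      by (simp add: dot_square_norm power2_eq_square)
    finally have "exp (- (2 * K * s)) * (2 * (d s \<bullet> d' s)) \<le> exp (- (2 * K * s)) * (2 * (K * (d s \<bullet> d s)))"
      by (intro mult_left_mono) auto
    then show ?thesis
      by (simp add: g'_def g_def algebra_simps)
  qed
  obtain s where s: "s \<in> {0..1}" "g 1 - g 0 = (1 - 0) * g' s"
    using mvt_very_simple[of 0 1 g "\<lambda>s h. h * g' s"] g' by fastforce
  with g'_le[OF s(1)] have "g 1 \<le> g 0"
    by simp
  then have "exp (- (2 * K)) * (norm (d 1))\<^sup>2 \<le> (norm (d 0))\<^sup>2"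
    by (simp add: g_def dot_square_norm)
  then have "exp (2 * K) * (exp (- (2 * K)) * (norm (d 1))\<^sup>2) \<le> exp (2 * K) * (norm (d 0))\<^sup>2"
    by (intro mult_left_mono) auto
  also have "exp (2 * K) * (exp (- (2 * K)) * (norm (d 1))\<^sup>2) = (norm (d 1))\<^sup>2"
    by (simp add: mult.assoc[symmetric] exp_minus)
  finally have "(norm (d 1))\<^sup>2 \<le> (exp K * norm (d 0))\<^sup>2"
    by (simp add: power_mult_distrib exp_double)
  then show ?thesis
    by (rule power2_le_imp_le) simp
qed

lemma segment_0_image: "(\<lambda>r. r * T) ` {0..1} = closed_segment 0 (T::real)"
  by (auto simp: closed_segment_def)

lemma has_vector_derivative_rescale:
  fixes f :: "real \<Rightarrow> 'a::real_normed_vector"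
  assumes "(f has_vector_derivative f') (at (r * T) within closed_segment 0 T)" "r \<in> {0..1}"
  shows "((\<lambda>r. f (r * T)) has_vector_derivative T *\<^sub>R f') (at r within {0..1})"
proof -
  have "((\<lambda>r. r * T) has_vector_derivative T) (at r within {0..1})"
    unfolding has_vector_derivative_def by (auto intro!: derivative_eq_intros)
  from vector_diff_chain_within[OF this, of f f'] assms show ?thesis
    by (simp add: segment_0_image o_def)
qed

text \<open>The substitution s = r T maps {0..1} onto \<open>closed_segment 0 T\<close> for either
  sign of \<open>T\<close>, so forward and backward time are one case; the factor |T| goes into the
  constant.\<close>

lemma gronwall:
  fixes d d' :: "real \<Rightarrow> 'a::real_inner"
  assumes der: "\<And>s. s \<in> closed_segment 0 T \<Longrightarrow>
                  (d has_vector_derivative d' s) (at s within closed_segment 0 T)"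
    and bound: "\<And>s. s \<in> closed_segment 0 T \<Longrightarrow> norm (d' s) \<le> K * norm (d s)"
  shows "norm (d T) \<le> exp (K * \<bar>T\<bar>) * norm (d 0)"
proof -
  have seg: "r * T \<in> closed_segment 0 T" if "r \<in> {0..1}" for r
    using that segment_0_image[of T] by blast
  have "norm (T *\<^sub>R d' (r * T)) \<le> K * \<bar>T\<bar> * norm (d (r * T))" if "r \<in> {0..1}" for r
  proof -
    have "\<bar>T\<bar> * norm (d' (r * T)) \<le> \<bar>T\<bar> * (K * norm (d (r * T)))"
      by (intro mult_left_mono bound seg that) auto
    then show ?thesis by (simp add: mult_ac)
  qed
  from gronwall_unit[OF has_vector_derivative_rescale[OF der[OF seg]] this]
  show ?thesis by simp
qed

lemma constant_on_segment:
  fixes d :: "real \<Rightarrow> 'a::real_inner"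
  assumes "\<And>s. s \<in> closed_segment 0 T \<Longrightarrow>
                  (d has_vector_derivative 0) (at s within closed_segment 0 T)"
  shows "d T = d 0"
proof -
  have "norm (d T - d 0) \<le> exp (0 * \<bar>T\<bar>) * norm (d 0 - d 0)"
    by (rule gronwall[of T "\<lambda>s. d s - d 0" "\<lambda>_. 0"]) (auto intro!: derivative_eq_intros assms)
  then show ?thesis by simp
qed

text \<open>The difference of the two integrals is the oriented integral from 0 to t, since
  \<open>integral {a..b} f\<close> vanishes for a > b. Near a given t it differs by a constant from
  the integral that starts at a fixed point -N further left, to which the fundamental theorem
  applies.\<close>

lemma antiderivative_UNIV:
  fixes f :: "real \<Rightarrow> 'a::banach"
  assumes f: "continuous_on UNIV f"
  obtains g where "g 0 = 0" "\<And>t. (g has_vector_derivative f t) (at t)"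
proof -
  define g where "g t = integral {0..t} f - integral {t..0} f" for t
  have "(g has_vector_derivative f t) (at t)" for t
  proof -
  define N where "N = \<bar>t\<bar> + 1"
  have int: "f integrable_on {a..b}" for a b
    by (intro integrable_continuous_real continuous_on_subset[OF f]) auto
  have g_eq: "g s = integral {-N..s} f - integral {-N..0} f" if s: "s \<in> {-N<..<N}" for s
  proof (cases "0 \<le> s")
    case True
    then have "integral {-N..0} f + integral {0..s} f = integral {-N..s} f"
      using s N_def by (intro Henstock_Kurzweil_Integration.integral_combine int) auto
    moreover have "integral {s..0} f = 0"
      using True by (cases "s = 0") auto
    ultimately show ?thesis by (simp add: g_def algebra_simps)
  next
    case False
    then have "integral {-N..s} f + integral {s..0} f = integral {-N..0} f"
      using s N_def by (intro Henstock_Kurzweil_Integration.integral_combine int) auto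
    with False show ?thesis by (simp add: g_def algebra_simps)
  qed
  have t: "t \<in> {-N<..<N}" by (auto simp: N_def)
  have "((\<lambda>u. integral {-N..u} f) has_vector_derivative f t) (at t within {-N..N})"
    using t by (intro integral_has_vector_derivative continuous_on_subset[OF f]) auto
  then have "((\<lambda>u. integral {-N..u} f) has_vector_derivative f t) (at t)"
    using t by (simp add: at_within_Icc_at)
  then have "((\<lambda>u. integral {-N..u} f - integral {-N..0} f) has_vector_derivative f t) (at t)"
    by (auto intro!: derivative_eq_intros)
  from has_vector_derivative_transform_within_open[OF this, of "{-N<..<N}" g] t g_eq
  show ?thesis by simp
  qed
  moreover have "g 0 = 0" by (simp add: g_def)
  ultimately show thesis using that by blast
qed

text \<open>Integrating K exp(2K|s|) M gives at most (M/2) exp(2K|t|), and the weight removes the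
  exponential. The remaining 1/2 becomes the contraction constant of Picard's operator. Working
  along r -> r t on {0..1} treats both signs of t.\<close>

lemma exp_weighted_bound:
  fixes g f :: "real \<Rightarrow> 'a::banach"
  assumes "K > 0" and der: "\<And>t. (g has_vector_derivative f t) (at t)" and "g 0 = 0"
    and bound: "\<And>s. norm (f s) \<le> K * exp (2 * K * \<bar>s\<bar>) * M"
  shows "norm (exp (- (2 * K * \<bar>t\<bar>)) *\<^sub>R g t) \<le> M / 2"
proof -
  let ?\<phi> = "\<lambda>r. M / 2 * exp (2 * K * r * \<bar>t\<bar>)"
  have M: "M \<ge> 0"
    using bound[of 0] \<open>K > 0\<close> order_trans[OF norm_ge_zero[of "f 0"]]
    by (fastforce simp: zero_le_mult_iff)
  have der_g: "((\<lambda>r. g (r * t)) has_vector_derivative t *\<^sub>R f (r * t)) (at r)" for r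
  proof -
    have "((\<lambda>r. r * t) has_vector_derivative t) (at r)"
      unfolding has_vector_derivative_def by (auto intro!: derivative_eq_intros)
    from vector_diff_chain_at[OF this der] show ?thesis
      by (simp add: o_def)
  qed
  have der_\<phi>: "(?\<phi> has_vector_derivative \<bar>t\<bar> * (K * exp (2 * K * r * \<bar>t\<bar>) * M)) (at r)" for r
    unfolding has_vector_derivative_def by (auto intro!: derivative_eq_intros simp: algebra_simps)
  have "norm (g (1 * t) - g (0 * t)) \<le> ?\<phi> 1 - ?\<phi> 0"
  proof (rule differentiable_bound_general[OF _ _ _ der_g der_\<phi>])
    show "continuous_on {0..1} (\<lambda>r. g (r * t))"
      by (intro continuous_at_imp_continuous_on ballI has_vector_derivative_continuous[OF der_g])
    show "continuous_on {0..1} ?\<phi>"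
      by (intro continuous_intros)
    fix r :: real assume "0 < r" "r < 1"
    then have "norm (f (r * t)) \<le> K * exp (2 * K * r * \<bar>t\<bar>) * M"
      using bound[of "r * t"] by (simp add: abs_mult mult_ac)
    then show "norm (t *\<^sub>R f (r * t)) \<le> \<bar>t\<bar> * (K * exp (2 * K * r * \<bar>t\<bar>) * M)"
      by (simp add: mult_left_mono)
  qed auto
  then have "norm (g t) \<le> M / 2 * exp (2 * K * \<bar>t\<bar>)"
    using M \<open>g 0 = 0\<close> by simp
  then have "exp (- (2 * K * \<bar>t\<bar>)) * norm (g t) \<le> exp (- (2 * K * \<bar>t\<bar>)) * (M / 2 * exp (2 * K * \<bar>t\<bar>))"
    by (intro mult_left_mono) auto
  then show ?thesis
    by (simp add: exp_minus field_simps)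
qed

text \<open>
  With the weight \<open>exp (- 2 k \<bar>t\<bar>)\<close> on the deviation from \<open>x\<close>, Picard's operator is a contraction of the
  bounded continuous functions on the whole real line, so no local solutions have to be glued.
\<close>

theorem picard_lindelof_global:
  fixes X :: "'a::{banach, heine_borel} \<Rightarrow> 'a"
  assumes lip: "K-lipschitz_on UNIV X" and bdd: "\<And>x. norm (X x) \<le> C"
  obtains y where "y 0 = x" "\<And>t. (y has_vector_derivative X (y t)) (at t)"
proof -
  \<comment> \<open>\<open>K\<close> may be 0, but the weight needs a positive rate.\<close>
  define k where "k = K + 1"
  have k: "k > 0" "dist (X a) (X b) \<le> k * dist a b" for a b
  proof -
    have "0 \<le> K" "dist (X a) (X b) \<le> K * dist a b" for a b
      using lip by (auto simp: lipschitz_on_def)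
    then show "k > 0" "dist (X a) (X b) \<le> k * dist a b" for a b
      by (auto simp: k_def distrib_right intro: add_increasing2)
  qed
  have contX: "continuous_on UNIV X"
    using lip by (rule lipschitz_on_continuous_on)
  \<comment> \<open>\<open>z\<close> is the weighted deviation exp(-2k|s|) (y(s) - x), so
    \<open>f z\<close> is the field along the curve y that \<open>z\<close> encodes.\<close>
  define f where "f z s = X (x + exp (2 * k * \<bar>s\<bar>) *\<^sub>R apply_bcontfun z s)" for z s
  have contf: "continuous_on UNIV (f z)" for z
    unfolding f_def by (intro continuous_intros continuous_on_compose2[OF contX]) auto
  define A where "A z = (SOME g. g 0 = 0 \<and> (\<forall>t. (g has_vector_derivative f z t) (at t)))" for z
  have A: "A z 0 = 0" "(A z has_vector_derivative f z t) (at t)" for z t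
  proof -
    have "\<exists>g. g 0 = 0 \<and> (\<forall>t. (g has_vector_derivative f z t) (at t))"
      using antiderivative_UNIV[OF contf] by metis
    from someI_ex[OF this] show "A z 0 = 0" "(A z has_vector_derivative f z t) (at t)" for t
      by (auto simp: A_def)
  qed
  have contA: "continuous_on UNIV (A z)" for z
    using A(2) by (meson continuous_at_imp_continuous_on has_vector_derivative_continuous)
  define P where "P z t = exp (- (2 * k * \<bar>t\<bar>)) *\<^sub>R A z t" for z t
  have P_bcontfun: "P z \<in> bcontfun" for z
  proof -
    have "C \<ge> 0" using bdd[of x] norm_ge_zero order_trans by blast
    have "norm (f z s) \<le> k * exp (2 * k * \<bar>s\<bar>) * (C / k)" for s
    proof -
      have "norm (f z s) \<le> C * 1" using bdd by (simp add: f_def)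
      also have "\<dots> \<le> C * exp (2 * k * \<bar>s\<bar>)"
        using \<open>C \<ge> 0\<close> k(1) by (intro mult_left_mono) auto
      finally show ?thesis using k(1) by (simp add: mult_ac)
    qed
    from exp_weighted_bound[OF k(1) A(2) A(1) this]
    have "norm (P z t) \<le> C / k / 2" for t by (simp add: P_def)
    moreover have "continuous_on UNIV (P z)"
      unfolding P_def by (intro continuous_intros contA)
    ultimately show ?thesis
      by (intro bcontfun_normI)
  qed
  have contraction: "dist (Bcontfun (P z)) (Bcontfun (P z')) \<le> (1/2) * dist z z'" for z z'
  proof (rule dist_bound)
    fix t
    have "norm (f z s - f z' s) \<le> k * exp (2 * k * \<bar>s\<bar>) * dist z z'" for s
    proof -
      have "norm (f z s - f z' s) \<le> k * (exp (2 * k * \<bar>s\<bar>) * dist (apply_bcontfun z s) (apply_bcontfun z' s))"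
        using k(2)[of "x + exp (2 * k * \<bar>s\<bar>) *\<^sub>R apply_bcontfun z s" "x + exp (2 * k * \<bar>s\<bar>) *\<^sub>R apply_bcontfun z' s"]
        by (simp add: f_def dist_norm flip: scaleR_diff_right)
      also have "\<dots> \<le> k * (exp (2 * k * \<bar>s\<bar>) * dist z z')"
        using k(1) by (intro mult_left_mono dist_bounded) auto
      finally show ?thesis by (simp add: mult_ac)
    qed
    from exp_weighted_bound[OF k(1) _ _ this, of "\<lambda>t. A z t - A z' t" t]
    show "dist (apply_bcontfun (Bcontfun (P z)) t) (apply_bcontfun (Bcontfun (P z')) t) \<le> 1/2 * dist z z'"
      by (simp add: Bcontfun_inverse[OF P_bcontfun] P_def dist_norm A has_vector_derivative_diff
               flip: scaleR_diff_right)
  qed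
  then obtain z where "Bcontfun (P z) = z"
    using banach_fix_type[of "1/2" "\<lambda>z. Bcontfun (P z)"] by auto
  then have z: "apply_bcontfun z = P z"
    by (metis Bcontfun_inverse P_bcontfun)
  show thesis
  proof
    show "x + A z 0 = x" by (simp add: A)
    have "f z t = X (x + A z t)" for t
      by (simp add: f_def z P_def exp_minus)
    then show "((\<lambda>t. x + A z t) has_vector_derivative X (x + A z t)) (at t)" for t
      using A(2)[of z t] by (auto intro!: derivative_eq_intros)
  qed
qed


section \<open>Motions on the unit sphere\<close>

definition sphere_field :: "('a \<Rightarrow> 'a) \<Rightarrow> 'a \<times> real \<Rightarrow> 'a::real_inner \<times> real" where
  "sphere_field F x = (snd x *\<^sub>R F (fst x), - (F (fst x) \<bullet> fst x))"

definition sphere_motion :: "('a \<Rightarrow> 'a) \<Rightarrow> (real \<Rightarrow> 'a::real_inner \<times> real) \<Rightarrow> bool" where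
  "sphere_motion F x \<longleftrightarrow>
     (\<forall>t. x t \<in> sphere 0 1 \<and> (x has_vector_derivative sphere_field F (x t)) (at t))"

text \<open>The two terms with F(\<xi>) . \<xi> cancel, so the field is tangent to the spheres about
  0; this is what keeps solutions on the unit sphere.\<close>

lemma inner_sphere_field: "x \<bullet> sphere_field F x = 0"
  by (cases x) (simp add: sphere_field_def inner_prod_def inner_commute)

lemma fst_in_cball: "x \<in> cball 0 1 \<Longrightarrow> fst x \<in> cball 0 1" for x :: "'a::real_inner \<times> real"
  using norm_fst_le[of "fst x" "snd x"] by (auto simp: dist_norm)

lemma snd_in_cball: "x \<in> cball 0 1 \<Longrightarrow> \<bar>snd x\<bar> \<le> 1" for x :: "'a::real_inner \<times> real"
  using norm_snd_le[of "snd x" "fst x"] by (auto simp: dist_norm)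

lemma sphere_field_bound:
  assumes F: "\<And>\<xi>. \<xi> \<in> cball 0 1 \<Longrightarrow> norm (F \<xi>) \<le> C" and x: "x \<in> cball 0 1"
  shows "norm (sphere_field F x) \<le> C + C"
proof -
  have 1: "norm (snd x *\<^sub>R F (fst x)) \<le> C"
    using snd_in_cball[OF x] F[OF fst_in_cball[OF x]]
    by (simp add: order_trans[OF mult_left_le_one_le])
  have "\<bar>F (fst x) \<bullet> fst x\<bar> \<le> norm (F (fst x)) * norm (fst x)"
    by (rule Cauchy_Schwarz_ineq2)
  also have "\<dots> \<le> C"
    using fst_in_cball[OF x] F[OF fst_in_cball[OF x]]
    by (simp add: order_trans[OF mult_right_le_one_le])
  finally show ?thesis
    using norm_Pair_le[of "snd x *\<^sub>R F (fst x)" "- (F (fst x) \<bullet> fst x)"] 1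
    by (simp add: sphere_field_def)
qed

text \<open>Both components are products of a factor bounded by 1 and one bounded by
  \<open>C\<close>; splitting the difference of products contributes C + K for each.\<close>

lemma sphere_field_lipschitz:
  assumes lip: "K-lipschitz_on (cball 0 1) F"
    and F: "\<And>\<xi>. \<xi> \<in> cball 0 1 \<Longrightarrow> norm (F \<xi>) \<le> C"
  shows "(2 * C + 2 * K)-lipschitz_on (cball 0 1) (sphere_field F)"
proof (rule lipschitz_onI)
  have C: "C \<ge> 0" using F[of 0] norm_ge_zero[of "F 0"] by (meson centre_in_cball order_trans zero_le_one)
  moreover have K: "K \<ge> 0" using lip by (rule lipschitz_on_nonneg)
  ultimately show "0 \<le> 2 * C + 2 * K" by simp
  fix x y :: "'a \<times> real" assume x: "x \<in> cball 0 1" and y: "y \<in> cball 0 1"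
  let ?F = "\<lambda>x. F (fst x)" and ?D = "dist x y"
  have D: "norm (fst x - fst y) \<le> ?D" "\<bar>snd x - snd y\<bar> \<le> ?D"
    using dist_fst_le[of x y] dist_snd_le[of x y] by (auto simp: dist_norm)
  have "norm (?F x - ?F y) \<le> K * norm (fst x - fst y)"
    using lipschitz_on_normD[OF lip fst_in_cball[OF x] fst_in_cball[OF y]] .
  also have "\<dots> \<le> K * ?D" using D K by (intro mult_left_mono)
  finally have FD: "norm (?F x - ?F y) \<le> K * ?D" .
  have "norm ((snd x - snd y) *\<^sub>R ?F x + snd y *\<^sub>R (?F x - ?F y))
        \<le> \<bar>snd x - snd y\<bar> * norm (?F x) + \<bar>snd y\<bar> * norm (?F x - ?F y)"
    by (rule norm_triangle_le) simp
  also have "\<dots> \<le> ?D * C + 1 * (K * ?D)"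
    using D F[OF fst_in_cball[OF x]] snd_in_cball[OF y] FD by (intro add_mono mult_mono) auto
  finally have 1: "norm (snd x *\<^sub>R ?F x - snd y *\<^sub>R ?F y) \<le> (C + K) * ?D"
    by (simp add: algebra_simps)
  have "\<bar>?F x \<bullet> (fst x - fst y) + (?F x - ?F y) \<bullet> fst y\<bar>
        \<le> norm (?F x) * norm (fst x - fst y) + norm (?F x - ?F y) * norm (fst y)"
    by (rule order_trans[OF abs_triangle_ineq]) (intro add_mono Cauchy_Schwarz_ineq2)
  also have "\<dots> \<le> C * ?D + K * ?D * 1"
    using D F[OF fst_in_cball[OF x]] fst_in_cball[OF y] FD C K by (intro add_mono mult_mono) auto
  finally have 2: "\<bar>?F y \<bullet> fst y - ?F x \<bullet> fst x\<bar> \<le> (C + K) * ?D"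
    by (simp add: algebra_simps inner_diff_left inner_diff_right)
  have "dist (sphere_field F x) (sphere_field F y) \<le> norm (snd x *\<^sub>R ?F x - snd y *\<^sub>R ?F y)
         + norm (?F y \<bullet> fst y - ?F x \<bullet> fst x)"
    using norm_Pair_le[of "snd x *\<^sub>R ?F x - snd y *\<^sub>R ?F y" "?F y \<bullet> fst y - ?F x \<bullet> fst x"]
    by (simp add: sphere_field_def dist_norm)
  with 1 2 show "dist (sphere_field F x) (sphere_field F y) \<le> (2 * C + 2 * K) * ?D"
    by (simp add: algebra_simps)
qed

text \<open>Serves to bound, by a multiple of |x|^2 - 1 itself, the failure of the projected field
  to be tangent at x, so that Gronwall applies to |x|^2 - 1. Outside the ball the competitor x / |x|
  gives |x| - 1 \<le> |x|^2 - 1.\<close>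

lemma dist_closest_point_cball:
  fixes x :: "'a::euclidean_space"
  shows "dist x (closest_point (cball 0 1) x) \<le> \<bar>(norm x)\<^sup>2 - 1\<bar>"
proof (cases "norm x \<le> 1")
  case True
  then show ?thesis by (simp add: closest_point_self)
next
  case False
  then have n: "norm x > 1" "x \<noteq> 0" by auto
  have "dist x (closest_point (cball 0 1) x) \<le> dist x (x /\<^sub>R norm x)"
    using n by (intro closest_point_le) auto
  also have "dist x (x /\<^sub>R norm x) = \<bar>1 - 1 / norm x\<bar> * norm x"
  proof -
    have "x - x /\<^sub>R norm x = (1 - 1 / norm x) *\<^sub>R x"
      by (simp add: scaleR_diff_left divide_inverse)
    then show ?thesis
      by (simp only: dist_norm norm_scaleR)
  qed
  also have "\<dots> = norm x - 1"
    using n by (simp add: abs_if field_simps)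
  also have "\<dots> \<le> (norm x)\<^sup>2 - 1"
    using n by (simp add: self_le_power)
  finally show ?thesis by simp
qed

context
  fixes F :: "'a::euclidean_space \<Rightarrow> 'a" and K :: real
  assumes lip: "K-lipschitz_on (cball 0 1) F"
begin

lemma bounded_on_cball: obtains C where "\<And>\<xi>. \<xi> \<in> cball 0 1 \<Longrightarrow> norm (F \<xi>) \<le> C"
proof -
  have "bounded (F ` cball 0 1)"
    by (intro compact_imp_bounded compact_continuous_image lipschitz_on_continuous_on[OF lip]) simp
  then show thesis using that unfolding bounded_iff by blast
qed

lemma sphere_field_lipschitz':
  obtains M where "M \<ge> 0" "M-lipschitz_on (cball 0 1) (sphere_field F)"
  using bounded_on_cball sphere_field_lipschitz[OF lip] lipschitz_on_nonneg by metis

lemma sphere_motion_exists: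
  assumes x0: "x0 \<in> sphere 0 1"
  obtains x where "sphere_motion F x" "x 0 = x0"
proof -
  obtain M where M: "M \<ge> 0" "M-lipschitz_on (cball 0 1) (sphere_field F)"
    by (rule sphere_field_lipschitz')
  obtain C where C: "\<And>x. x \<in> cball 0 1 \<Longrightarrow> norm (sphere_field F x) \<le> C"
    using bounded_on_cball sphere_field_bound by metis
  (* F is only controlled on the unit ball, so the field is first composed with the projection to the ball. *)
  let ?p = "closest_point (cball 0 1) :: 'a \<times> real \<Rightarrow> _"
  have p: "?p x \<in> cball 0 1" for x by (intro closest_point_in_set) auto
  have "M-lipschitz_on UNIV (\<lambda>x. sphere_field F (?p x))"
  proof (rule lipschitz_onI)
    fix x y
    have "dist (sphere_field F (?p x)) (sphere_field F (?p y)) \<le> M * dist (?p x) (?p y)"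
      using lipschitz_onD[OF M(2) p p] .
    also have "\<dots> \<le> M * dist x y"
      using M(1) by (intro mult_left_mono closest_point_lipschitz) auto
    finally show "dist (sphere_field F (?p x)) (sphere_field F (?p y)) \<le> M * dist x y" .
  qed (fact M(1))
  from picard_lindelof_global[OF this C[OF p]]
  obtain x where x: "x 0 = x0" "\<And>t. (x has_vector_derivative sphere_field F (?p (x t))) (at t)"
    by metis
  have "C \<ge> 0" using C[of 0] norm_ge_zero order_trans by (metis centre_in_cball zero_le_one)
  \<comment> \<open>|x|^2 - 1 vanishes at time 0. Tangency holds at \<open>?p (x s)\<close>, so only
    the part x - ?p x contributes to its derivative, which is therefore at most 2C times its own
    size.\<close>
  have sph: "(norm (x t))\<^sup>2 = 1" for t
  proof -
    have "norm ((norm (x t))\<^sup>2 - 1) \<le> exp (2 * C * \<bar>t\<bar>) * norm ((norm (x 0))\<^sup>2 - 1)"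
    proof (rule gronwall[of t "\<lambda>t. (norm (x t))\<^sup>2 - 1" "\<lambda>s. 2 * (x s \<bullet> sphere_field F (?p (x s)))"])
      fix s
      show "((\<lambda>t. (norm (x t))\<^sup>2 - 1) has_vector_derivative 2 * (x s \<bullet> sphere_field F (?p (x s))))
              (at s within closed_segment 0 t)"
        using has_vector_derivative_at_within[OF x(2)[of s], of "closed_segment 0 t"]
        unfolding has_vector_derivative_def power2_norm_eq_inner
        by (auto intro!: derivative_eq_intros simp: inner_commute algebra_simps)
      have "x s \<bullet> sphere_field F (?p (x s)) = (x s - ?p (x s)) \<bullet> sphere_field F (?p (x s))"
        by (simp add: inner_diff_left inner_sphere_field)
      also have "\<bar>\<dots>\<bar> \<le> norm (x s - ?p (x s)) * norm (sphere_field F (?p (x s)))"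
        by (rule Cauchy_Schwarz_ineq2)
      also have "\<dots> \<le> \<bar>(norm (x s))\<^sup>2 - 1\<bar> * C"
        using dist_closest_point_cball[of "x s"] C[OF p] by (intro mult_mono) (auto simp: dist_norm)
      finally show "norm (2 * (x s \<bullet> sphere_field F (?p (x s)))) \<le> 2 * C * norm ((norm (x s))\<^sup>2 - 1)"
        by (simp add: mult_ac)
    qed
    then show ?thesis using x(1) x0 by simp
  qed
  then have norm: "norm (x t) = 1" for t
    by (metis norm_ge_zero power2_eq_1_iff zero_le_square neg_0_le_iff_le not_one_le_zero)
  then have "?p (x t) = x t" for t by (simp add: closest_point_self)
  with x norm have "sphere_motion F x" by (simp add: sphere_motion_def)
  with x(1) that show thesis by blast
qed

text \<open>The exponent \<open>M\<close> comes from \<open>F\<close> alone and not from the two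
  solutions, as continuous dependence requires. The solutions are taken on the segment only, which
  is what \<open>LF_flow\<close> provides.\<close>

lemma sphere_solutions_dist:
  obtains M where
    "\<And>x y t. (\<And>s. s \<in> closed_segment 0 t \<Longrightarrow> x s \<in> sphere 0 1 \<and> y s \<in> sphere 0 1 \<and>
         (x has_vector_derivative sphere_field F (x s)) (at s within closed_segment 0 t) \<and>
         (y has_vector_derivative sphere_field F (y s)) (at s within closed_segment 0 t)) \<Longrightarrow>
       dist (x t) (y t) \<le> exp (M * \<bar>t\<bar>) * dist (x 0) (y 0)"
proof -
  obtain M where M: "M \<ge> 0" "M-lipschitz_on (cball 0 1) (sphere_field F)"
    by (rule sphere_field_lipschitz')
  have "dist (x t) (y t) \<le> exp (M * \<bar>t\<bar>) * dist (x 0) (y 0)"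
    if xy: "\<And>s. s \<in> closed_segment 0 t \<Longrightarrow> x s \<in> sphere 0 1 \<and> y s \<in> sphere 0 1 \<and>
         (x has_vector_derivative sphere_field F (x s)) (at s within closed_segment 0 t) \<and>
         (y has_vector_derivative sphere_field F (y s)) (at s within closed_segment 0 t)" for x y t
    unfolding dist_norm
  proof (rule gronwall[of t "\<lambda>s. x s - y s" "\<lambda>s. sphere_field F (x s) - sphere_field F (y s)"])
    fix s assume s: "s \<in> closed_segment 0 t"
    show "((\<lambda>s. x s - y s) has_vector_derivative sphere_field F (x s) - sphere_field F (y s))
            (at s within closed_segment 0 t)"
      using xy[OF s] by (intro has_vector_derivative_diff) auto
    show "norm (sphere_field F (x s) - sphere_field F (y s)) \<le> M * norm (x s - y s)"
      using xy[OF s] by (intro lipschitz_on_normD[OF M(2)]) auto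
  qed
  then show thesis by (rule that)
qed

lemma sphere_solution_unique:
  assumes "sphere_motion F x" "x 0 = y 0"
    and "\<And>s. s \<in> closed_segment 0 t \<Longrightarrow> y s \<in> sphere 0 1 \<and>
         (y has_vector_derivative sphere_field F (y s)) (at s within closed_segment 0 t)"
  shows "x t = y t"
proof -
  obtain M where "dist (x t) (y t) \<le> exp (M * \<bar>t\<bar>) * dist (x 0) (y 0)"
    using sphere_solutions_dist assms unfolding sphere_motion_def
    by (metis (no_types, lifting) has_vector_derivative_at_within)
  with assms(2) show ?thesis by simp
qed

lemma sphere_motion_dist:
  obtains M where "\<And>x y t. sphere_motion F x \<Longrightarrow> sphere_motion F y \<Longrightarrow>
       dist (x t) (y t) \<le> exp (M * \<bar>t\<bar>) * dist (x 0) (y 0)"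
  using sphere_solutions_dist unfolding sphere_motion_def
  by (metis (no_types, lifting) has_vector_derivative_at_within)

lemma sphere_motion_unique:
  assumes "sphere_motion F x" "sphere_motion F y" "x 0 = y 0"
  shows "x = y"
proof
  fix t
  obtain M where "dist (x t) (y t) \<le> exp (M * \<bar>t\<bar>) * dist (x 0) (y 0)"
    using sphere_motion_dist assms by metis
  with assms(3) show "x t = y t" by simp
qed

end

lemma sphere_motion_shift:
  assumes "sphere_motion F x"
  shows "sphere_motion F (\<lambda>t. x (t + a))"
proof -
  have "((\<lambda>t. t + a) has_vector_derivative 1) (at t)" for t
    by (auto intro!: derivative_eq_intros)
  from vector_diff_chain_at[OF this] assms show ?thesis
    by (fastforce simp: sphere_motion_def o_def)
qed

definition flip :: "'a \<times> real \<Rightarrow> 'a::real_inner \<times> real" where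
  "flip x = (fst x, - snd x)"

lemma sphere_motion_reverse:
  assumes "sphere_motion F x"
  shows "sphere_motion F (\<lambda>t. flip (x (a - t)))"
  unfolding sphere_motion_def
proof (intro allI conjI)
  fix t
  show "flip (x (a - t)) \<in> sphere 0 1"
    using assms by (auto simp: sphere_motion_def flip_def norm_Pair norm_prod_def)
  have "((\<lambda>t. a - t) has_vector_derivative -1) (at t)"
    by (auto intro!: derivative_eq_intros)
  from vector_diff_chain_at[OF this, of x "sphere_field F (x (a - t))"] assms
  have "((\<lambda>t. x (a - t)) has_vector_derivative - sphere_field F (x (a - t))) (at t)"
    by (simp add: sphere_motion_def o_def)
  then have "((\<lambda>t. flip (x (a - t))) has_vector_derivative flip (- sphere_field F (x (a - t)))) (at t)"
    unfolding flip_def has_vector_derivative_def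
    by (auto intro!: derivative_eq_intros)
  then show "((\<lambda>t. flip (x (a - t))) has_vector_derivative sphere_field F (flip (x (a - t)))) (at t)"
    by (simp add: flip_def sphere_field_def)
qed

text \<open>Without the flip, reversing time replaces \<open>F\<close> by its negative. This reduces
  the backward half of an escaping curve to the forward half.\<close>

lemma sphere_motion_uminus:
  assumes "sphere_motion F x"
  shows "sphere_motion (\<lambda>\<xi>. - F \<xi>) (\<lambda>t. x (- t))"
  unfolding sphere_motion_def
proof (intro allI conjI)
  fix t
  show "x (- t) \<in> sphere 0 1"
    using assms by (simp add: sphere_motion_def)
  have "(uminus has_vector_derivative -1) (at t)"
    by (auto intro!: derivative_eq_intros)
  from vector_diff_chain_at[OF this, of x "sphere_field F (x (- t))"] assms
  show "((\<lambda>t. x (- t)) has_vector_derivative sphere_field (\<lambda>\<xi>. - F \<xi>) (x (- t))) (at t)"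
    by (simp add: sphere_motion_def sphere_field_def o_def)
qed


section \<open>Oscillating motions\<close>

lemma continuous_on_sphere_motion: "sphere_motion F x \<Longrightarrow> continuous_on A x"
  unfolding sphere_motion_def
  by (intro continuous_at_imp_continuous_on ballI) (blast intro: has_vector_derivative_continuous)

text \<open>The zeros in {r..t} form a compact set, whose least element is b; a nonpositive value
  before b would give an earlier zero by the intermediate value theorem.\<close>

lemma first_zero_after:
  fixes h :: "real \<Rightarrow> real"
  assumes cont: "continuous_on UNIV h" and "r < t" "0 < h r" "h t \<le> 0"
  obtains b where "r < b" "b \<le> t" "h b = 0" "\<And>s. r \<le> s \<Longrightarrow> s < b \<Longrightarrow> 0 < h s"
proof -
  note cont' = continuous_on_subset[OF cont subset_UNIV]
  define Z where "Z = {r..t} \<inter> h -` {0}"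
  have "compact Z"
    unfolding Z_def by (intro compact_Int_closed closed_vimage[OF _ cont]) auto
  moreover have "\<exists>s\<ge>r. s \<le> t \<and> h s = 0"
    using assms cont' by (intro IVT2') auto
  then have "Z \<noteq> {}"
    by (auto simp: Z_def)
  ultimately obtain b where "b \<in> Z" "\<And>s. s \<in> Z \<Longrightarrow> b \<le> s"
    using compact_attains_inf[of Z] by blast
  then have b: "b \<in> {r..t}" "h b = 0" and min: "\<And>s. s \<in> {r..t} \<Longrightarrow> h s = 0 \<Longrightarrow> b \<le> s"
    by (auto simp: Z_def)
  have "0 < h s" if "r \<le> s" "s < b" for s
  proof (rule ccontr)
    assume "\<not> 0 < h s"
    then have "\<exists>s'\<ge>r. s' \<le> s \<and> h s' = 0"
      using assms cont' that by (intro IVT2') auto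
    then obtain s' where "r \<le> s'" "s' \<le> s" "h s' = 0"
      by blast
    with min[of s'] that b show False by auto
  qed
  moreover have "r < b" using b \<open>0 < h r\<close> by (cases "r = b") auto
  ultimately show thesis using that b by auto
qed

definition oscillating :: "(real \<Rightarrow> 'a \<times> real) \<Rightarrow> bool" where
  "oscillating x \<longleftrightarrow> (\<exists>t0 t1 t2. t0 < t1 \<and> t1 < t2 \<and> snd (x t0) < 0 \<and> 0 < snd (x t1) \<and> snd (x t2) < 0)"

lemma oscillating_shift:
  assumes "oscillating x"
  shows "oscillating (\<lambda>t. x (t + a))"
proof -
  obtain t0 t1 t2 where "t0 < t1" "t1 < t2" "snd (x t0) < 0" "0 < snd (x t1)" "snd (x t2) < 0"
    using assms by (auto simp: oscillating_def)
  then show ?thesis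
    unfolding oscillating_def
    by (intro exI[of _ "t0 - a"] exI[of _ "t1 - a"] exI[of _ "t2 - a"]) auto
qed

text \<open>On the unit sphere \<eta> = 0 means |\<xi>| = 1, so for a motion this is one passage of
  \<xi> through the ball from boundary to boundary, half of an oscillation.\<close>

definition bounce :: "(real \<Rightarrow> 'a \<times> real) \<Rightarrow> real \<Rightarrow> real \<Rightarrow> bool" where
  "bounce x a b \<longleftrightarrow> a < b \<and> snd (x a) = 0 \<and> snd (x b) = 0 \<and> (\<forall>t\<in>{a<..<b}. 0 < snd (x t))"

text \<open>Starting at the middle time, where \<eta> > 0, the first zero forwards is the right end;
  the first zero of the time-reversed function gives the left end.\<close>

lemma oscillating_imp_bounce:
  assumes "sphere_motion F x" "oscillating x"
  obtains a b where "bounce x a b"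
proof -
  obtain t0 t1 t2 where t: "t0 < t1" "t1 < t2" "snd (x t0) < 0" "0 < snd (x t1)" "snd (x t2) < 0"
    using assms(2) by (auto simp: oscillating_def)
  have cont: "continuous_on UNIV (\<lambda>t. snd (x t))" "continuous_on UNIV (\<lambda>t. snd (x (- t)))"
    using continuous_on_sphere_motion[OF assms(1)]
    by (auto intro!: continuous_intros continuous_on_compose2[where f=uminus])
  obtain b where b: "t1 < b" "snd (x b) = 0" "\<And>s. t1 \<le> s \<Longrightarrow> s < b \<Longrightarrow> 0 < snd (x s)"
    using first_zero_after[OF cont(1), of t1 t2] t by auto
  obtain a where a: "- t1 < a" "snd (x (- a)) = 0" "\<And>s. - t1 \<le> s \<Longrightarrow> s < a \<Longrightarrow> 0 < snd (x (- s))"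
    using first_zero_after[OF cont(2), of "- t1" "- t0"] t by auto
  have "0 < snd (x s)" if "- a < s" "s < b" for s
    using a(3)[of "- s"] b(3)[of s] that by (cases "t1 \<le> s") auto
  with a(1,2) b(1,2) have "bounce x (- a) b" by (auto simp: bounce_def)
  then show thesis by (rule that)
qed

context
  fixes F :: "'a::euclidean_space \<Rightarrow> 'a" and K :: real
  assumes lip: "K-lipschitz_on (cball 0 1) F"
begin

text \<open>\<open>flip\<close> fixes \<open>x a\<close>, so the motion and its reversal about
  \<open>a\<close> are two motions that agree at one time.\<close>

lemma sphere_motion_reflect:
  assumes x: "sphere_motion F x" and "snd (x a) = 0"
  shows "x (a + t) = flip (x (a - t))"
proof -
  have "(\<lambda>t. x (t + a)) = (\<lambda>t. flip (x (a - t)))"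
    using sphere_motion_unique[OF lip sphere_motion_shift[OF x] sphere_motion_reverse[OF x], of a a] assms(2)
    by (simp add: flip_def prod_eq_iff)
  then show ?thesis by (metis add.commute)
qed

lemma sphere_motion_same_value:
  assumes x: "sphere_motion F x" and "x s = x t"
  shows "x (r + (t - s)) = x r"
proof -
  have "(\<lambda>r. x (r + t)) = (\<lambda>r. x (r + s))"
    using sphere_motion_unique[OF lip sphere_motion_shift[OF x] sphere_motion_shift[OF x], of t s] assms(2)
    by simp
  from fun_cong[OF this, of "r - s"] show ?thesis by (simp add: algebra_simps)
qed

text \<open>The time reflections about \<open>a\<close> and \<open>b\<close> compose to the
  translation by 2 (b - a), and the two flips cancel.\<close>

lemma bounce_periodic:
  assumes x: "sphere_motion F x" and "bounce x a b"
  shows "x (t + 2 * (b - a)) = x t"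
proof -
  have ab: "snd (x a) = 0" "snd (x b) = 0" using assms(2) by (auto simp: bounce_def)
  have "x (t + 2 * (b - a)) = flip (x (a + (a - t)))"
    using sphere_motion_reflect[OF x ab(2), of "t + b - 2 * a"] by (simp add: algebra_simps)
  also have "x (a + (a - t)) = flip (x t)"
    using sphere_motion_reflect[OF x ab(1), of "a - t"] by simp
  finally show ?thesis by (simp add: flip_def)
qed

lemma bounce_periodic_int:
  assumes x: "sphere_motion F x" and "bounce x a b"
  shows "x (t + of_int m * (2 * (b - a))) = x t"
proof -
  interpret periodic_fun_simple x "2 * (b - a)"
    by standard (rule bounce_periodic[OF assms])
  show ?thesis by (rule plus_of_int)
qed

text \<open>Two equal values make t - s a period, hence also its remainder d modulo T; the signs of
  \<eta> exclude every d strictly between 0 and T.\<close>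

lemma bounce_minimal_period:
  assumes x: "sphere_motion F x" and bounce: "bounce x a b" and eq: "x s = x t"
  shows "\<exists>m::int. t - s = of_int m * (2 * (b - a))"
proof -
  define T where "T = 2 * (b - a)"
  define m where "m = \<lfloor>(t - s) / T\<rfloor>"
  define d where "d = t - s - of_int m * T"
  have ab: "a < b" "snd (x a) = 0" "snd (x b) = 0" "\<And>t. a < t \<Longrightarrow> t < b \<Longrightarrow> 0 < snd (x t)"
    using bounce by (auto simp: bounce_def)
  have T: "T > 0" using ab by (simp add: T_def)
  have d: "0 \<le> d" "d < T"
    using floor_divide_lower[OF T, of "t - s"] floor_divide_upper[OF T, of "t - s"]
    by (auto simp: d_def m_def algebra_simps)
  have per: "x (r + d) = x r" for r
    using sphere_motion_same_value[OF x eq, of r]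
      bounce_periodic_int[OF x bounce, of "r + d" m, folded T_def]
    by (simp add: d_def algebra_simps)
  have refl: "snd (x (2 * b - r)) = - snd (x r)" for r
    using sphere_motion_reflect[OF x ab(3), of "b - r"] by (simp add: flip_def)
  have "d = 0"
  proof (rule ccontr)
    assume "d \<noteq> 0"
    with d have "d > 0" by simp
    \<comment> \<open>\<eta> vanishes at a + d and at its mirror image 2b - a - d about b. Both lie
      after a and neither lies in (a, b), which leaves only d = b - a.\<close>
    have zero: "snd (x (a + d)) = 0" using per ab by simp
    then have "snd (x (2 * b - (a + d))) = 0" by (simp add: refl)
    with ab(4)[of "2 * b - (a + d)"] ab(4)[of "a + d"] zero \<open>d > 0\<close> \<open>d < T\<close>
    have "d = b - a" by (force simp: T_def not_less)
    \<comment> \<open>The period d would carry the midpoint of (a, b) to its mirror image about b,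
      where \<eta> has the opposite sign.\<close>
    then have "2 * b - (a + b) / 2 = (a + b) / 2 + d"
      by (simp add: field_simps)
    then have "snd (x (2 * b - (a + b) / 2)) = snd (x ((a + b) / 2))"
      by (simp only: per)
    with ab(4)[of "(a + b) / 2"] ab(1) show False by (simp add: refl)
  qed
  then show ?thesis by (auto simp: d_def T_def)
qed

text \<open>At a zero of the field the motion would be constant, but \<eta> is 0 at \<open>a\<close>
  and positive at the midpoint. The torus will be immersed in the phase direction for this
  reason.\<close>

lemma sphere_field_nonzero:
  assumes x: "sphere_motion F x" and "bounce x a b"
  shows "sphere_field F (x t) \<noteq> 0"
proof
  assume "sphere_field F (x t) = 0"
  then have "sphere_motion F (\<lambda>_. x t)"
    using x by (auto simp: sphere_motion_def)
  from sphere_motion_unique[OF lip this sphere_motion_shift[OF x], of t]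
  have "x (r + t) = x t" for r by (simp add: fun_eq_iff)
  from this[of "a - t"] this[of "(a + b) / 2 - t"] have "x a = x ((a + b) / 2)" by simp
  moreover have "snd (x a) = 0" "0 < snd (x ((a + b) / 2))"
    using assms(2) by (auto simp: bounce_def)
  ultimately show False by simp
qed

text \<open>If \<eta> never became negative, it would stay positive, and the time change s with
  ds/dt = \<eta> would never reach the exit parameter b. Then \<eta> - \<mu> s would be bounded
  below by - \<mu> b while decreasing at a fixed rate.\<close>

lemma escape_forward:
  assumes x: "sphere_motion F x" and pos: "0 < snd (x 0)"
    and \<zeta>0: "\<zeta> 0 = fst (x 0)" and "0 \<le> b"
    and der: "\<And>s. s \<in> {0..b} \<Longrightarrow> (\<zeta> has_vector_derivative F (\<zeta> s)) (at s within {0..b})"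
    and inside: "\<And>s. s \<in> {0..<b} \<Longrightarrow> norm (\<zeta> s) < 1"
    and exit: "norm (\<zeta> b) = 1" "0 < F (\<zeta> b) \<bullet> \<zeta> b"
  obtains t where "t > 0" "snd (x t) < 0"
proof -
  have sph: "(norm (fst (x t)))\<^sup>2 + (snd (x t))\<^sup>2 = 1" for t
  proof -
    have "norm (x t) = 1" using x by (simp add: sphere_motion_def)
    then show ?thesis by (simp add: norm_prod_def)
  qed
  have der_x: "(x has_vector_derivative sphere_field F (x t)) (at t)" for t
    using x by (simp add: sphere_motion_def)
  have der_fst: "((\<lambda>t. fst (x t)) has_vector_derivative snd (x t) *\<^sub>R F (fst (x t))) (at t)" 
   and der_snd: "((\<lambda>t. snd (x t)) has_vector_derivative - (F (fst (x t)) \<bullet> fst (x t))) (at t)" for t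
    using der_x[of t, unfolded has_vector_derivative_def, THEN has_derivative_fst]
      der_x[of t, unfolded has_vector_derivative_def, THEN has_derivative_snd]
    by (auto simp: has_vector_derivative_def sphere_field_def)
  have cont_snd: "continuous_on A (\<lambda>t. snd (x t))" for A
    by (intro continuous_intros continuous_on_sphere_motion[OF x])
  have "\<exists>t>0. snd (x t) < 0"
  proof (rule ccontr)
    assume contra: "\<not> ?thesis"
    \<comment> \<open>At a zero t > 0 the reflection about t would give \<eta>(2t) = - \<eta>(0) <
      0.\<close>
    have pos': "0 < snd (x t)" if "t \<ge> 0" for t
    proof (rule ccontr)
      assume "\<not> 0 < snd (x t)"
      moreover from this pos that have t0: "t > 0"
        by (cases "t = 0") auto
      with contra have "\<not> snd (x t) < 0"
        by blast
      ultimately have t: "t > 0" "snd (x t) = 0"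
        using t0 by auto
      from t(1) contra have "\<not> snd (x (2 * t)) < 0"
        by simp
      with sphere_motion_reflect[OF x t(2), of t] pos show False
        by (simp add: flip_def)
    qed
    \<comment> \<open>The parameter on the integral curve of \<open>F\<close> that \<xi> has reached
      at time t.\<close>
    obtain s where s: "s 0 = 0" "\<And>t. (s has_vector_derivative snd (x t)) (at t)"
      using antiderivative_UNIV[OF cont_snd] by metis
    have s_mono: "s u \<le> s t" if "0 \<le> u" "u \<le> t" for u t
    proof (rule DERIV_nonneg_imp_nondecreasing[OF that(2)])
      fix r assume "u \<le> r" "r \<le> t"
      with pos'[of r] s(2)[of r] that show "\<exists>y. DERIV s r :> y \<and> y \<ge> 0"
        by (auto simp: has_real_derivative_iff_has_vector_derivative)
    qed
    \<comment> \<open>Both curves solve d\<xi>/dt = \<eta> F(\<xi>) with the same start, and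
      |\<eta>| \<le> 1 keeps the Lipschitz constant \<open>K\<close>.\<close>
    have follow: "fst (x t) = \<zeta> (s t)" if t: "0 \<le> t" "s t \<le> b" for t
    proof -
      have s_in: "s ` {0..t} \<subseteq> {0..b}"
        using s_mono[of 0] s_mono[of _ t] s(1) t by force
      have seg: "closed_segment 0 t = {0..t}" using t by (simp add: closed_segment_eq_real_ivl)
      have "norm (fst (x t) - \<zeta> (s t)) \<le> exp (K * \<bar>t\<bar>) * norm (fst (x 0) - \<zeta> (s 0))"
      proof (rule gronwall[of t "\<lambda>r. fst (x r) - \<zeta> (s r)" "\<lambda>r. snd (x r) *\<^sub>R F (fst (x r)) - snd (x r) *\<^sub>R F (\<zeta> (s r))"], unfold seg)
        fix r assume r: "r \<in> {0..t}"
        then have sr: "s r \<in> {0..b}" using s_in by blast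
        have "(\<zeta> has_vector_derivative F (\<zeta> (s r))) (at (s r) within s ` {0..t})"
          by (rule has_vector_derivative_within_subset[OF der[OF sr] s_in])
        from vector_diff_chain_within[OF has_vector_derivative_at_within[OF s(2)] this]
        have "((\<lambda>r. \<zeta> (s r)) has_vector_derivative snd (x r) *\<^sub>R F (\<zeta> (s r))) (at r within {0..t})"
          by (simp add: o_def)
        then show "((\<lambda>r. fst (x r) - \<zeta> (s r)) has_vector_derivative
            snd (x r) *\<^sub>R F (fst (x r)) - snd (x r) *\<^sub>R F (\<zeta> (s r))) (at r within {0..t})"
          by (intro has_vector_derivative_diff has_vector_derivative_at_within[OF der_fst])
        have "\<zeta> (s r) \<in> cball 0 1"
          using sr inside[of "s r"] exit by (cases "s r = b") auto
        moreover have xr: "x r \<in> cball 0 1" using x by (auto simp: sphere_motion_def)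
        ultimately have "norm (F (fst (x r)) - F (\<zeta> (s r))) \<le> K * norm (fst (x r) - \<zeta> (s r))"
          by (intro lipschitz_on_normD[OF lip] fst_in_cball) auto
        moreover have "\<bar>snd (x r)\<bar> * norm (F (fst (x r)) - F (\<zeta> (s r))) \<le> 1 * norm (F (fst (x r)) - F (\<zeta> (s r)))"
          using snd_in_cball[OF xr] by (intro mult_right_mono) auto
        ultimately show "norm (snd (x r) *\<^sub>R F (fst (x r)) - snd (x r) *\<^sub>R F (\<zeta> (s r))) \<le> K * norm (fst (x r) - \<zeta> (s r))"
          by (simp flip: scaleR_diff_right)
      qed
      then show ?thesis using s(1) \<zeta>0 by simp
    qed
    have cont_s: "continuous_on A s" for A
      by (intro continuous_at_imp_continuous_on ballI has_vector_derivative_continuous[OF s(2)])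
    \<comment> \<open>Where s reaches b, \<xi> = \<zeta>(b) lies on the unit sphere, which forces
      \<eta> = 0.\<close>
    have s_lt: "s t < b" if "t \<ge> 0" for t
    proof (rule ccontr)
      assume "\<not> s t < b"
      then have "\<exists>u\<ge>0. u \<le> t \<and> s u = b"
        using s(1) \<open>0 \<le> b\<close> that cont_s by (intro IVT') auto
      then obtain u where u: "0 \<le> u" "s u = b"
        by blast
      with follow[of u] exit have "snd (x u) = 0" using sph[of u] by simp
      with pos'[OF u(1)] show False by simp
    qed
    have cont_\<zeta>: "continuous_on {0..b} \<zeta>"
      using der by (meson continuous_on_eq_continuous_within has_vector_derivative_continuous)
    have \<zeta>_in: "\<zeta> ` {0..b} \<subseteq> cball 0 1"
      using inside exit by (force simp: le_less)
    have cont_F: "continuous_on {0..b} (\<lambda>s. F (\<zeta> s) \<bullet> \<zeta> s)"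
      by (intro continuous_intros cont_\<zeta> continuous_on_compose2[OF lipschitz_on_continuous_on[OF lip] cont_\<zeta> \<zeta>_in])
    \<comment> \<open>The minimum of this maximum will be \<delta>. It is positive because 1 -
      |\<zeta>|^2 > 0 before b, and at b itself the transversality F(\<zeta>) . \<zeta> > 0 takes
      over.\<close>
    have "continuous_on {0..b} (\<lambda>s. max (1 - (norm (\<zeta> s))\<^sup>2) (F (\<zeta> s) \<bullet> \<zeta> s))"
      by (intro continuous_intros cont_\<zeta> cont_F)
    then obtain s0 where s0: "s0 \<in> {0..b}" and
      min: "\<And>s. s \<in> {0..b} \<Longrightarrow> max (1 - (norm (\<zeta> s0))\<^sup>2) (F (\<zeta> s0) \<bullet> \<zeta> s0) \<le> max (1 - (norm (\<zeta> s))\<^sup>2) (F (\<zeta> s) \<bullet> \<zeta> s)"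
      using continuous_attains_inf[of "{0..b}" "\<lambda>s. max (1 - (norm (\<zeta> s))\<^sup>2) (F (\<zeta> s) \<bullet> \<zeta> s)"] \<open>0 \<le> b\<close>
      by (auto simp del: max.bounded_iff le_max_iff_disj)
    define \<delta> where "\<delta> = max (1 - (norm (\<zeta> s0))\<^sup>2) (F (\<zeta> s0) \<bullet> \<zeta> s0)"
    have "\<delta> > 0"
    proof (cases "s0 = b")
      case True
      then show ?thesis using exit by (simp add: \<delta>_def)
    next
      case False
      then have "(norm (\<zeta> s0))\<^sup>2 < 1" using inside[of s0] s0 by (simp add: power_less_one_iff)
      then show ?thesis by (simp add: \<delta>_def)
    qed
    obtain C where C: "\<And>s. s \<in> {0..b} \<Longrightarrow> \<bar>F (\<zeta> s) \<bullet> \<zeta> s\<bar> \<le> C" "C \<ge> 0"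
    proof -
      have "bounded ((\<lambda>s. F (\<zeta> s) \<bullet> \<zeta> s) ` {0..b})"
        by (intro compact_imp_bounded compact_continuous_image cont_F) simp
      then obtain C where "\<And>s. s \<in> {0..b} \<Longrightarrow> \<bar>F (\<zeta> s) \<bullet> \<zeta> s\<bar> \<le> C"
        unfolding bounded_iff by fastforce
      moreover from this[of 0] \<open>0 \<le> b\<close> have "C \<ge> 0" by (force intro: order_trans)
      ultimately show thesis by (rule that)
    qed
    (* At every s either 1 - |\<zeta> s|^2 = \<eta>^2 is at least \<delta>, or \<eta> decreases at rate at least \<delta>;
       hence \<eta> - \<mu> s always decreases at rate at least \<delta>. *)
    define \<mu> where "\<mu> = (C + \<delta>) / sqrt \<delta>"
    have \<mu>: "\<mu> \<ge> 0" using C(2) \<open>\<delta> > 0\<close> by (simp add: \<mu>_def)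
    define y where "y t = snd (x t) - \<mu> * s t" for t
    have y_der: "(y has_real_derivative - (F (fst (x t)) \<bullet> fst (x t)) - \<mu> * snd (x t)) (at t)" for t
      unfolding y_def using der_snd[of t] s(2)[of t]
      by (auto simp flip: has_real_derivative_iff_has_vector_derivative intro!: derivative_eq_intros)
    have y'_le: "- (F (fst (x t)) \<bullet> fst (x t)) - \<mu> * snd (x t) \<le> - \<delta>" if "t \<ge> 0" for t
    proof -
      have st: "s t \<in> {0..b}" using s_lt[OF that] s_mono[of 0 t] s(1) that by auto
      have eq: "fst (x t) = \<zeta> (s t)" using follow that st by simp
      show ?thesis
      proof (cases "\<delta> \<le> F (\<zeta> (s t)) \<bullet> \<zeta> (s t)")
        case True
        moreover have "0 \<le> \<mu> * snd (x t)" using \<mu> pos'[OF that] by simp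
        ultimately show ?thesis using eq by simp
      next
        case False
        then have "\<delta> \<le> 1 - (norm (\<zeta> (s t)))\<^sup>2"
          using min[OF st, folded \<delta>_def] by linarith
        then have "\<delta> \<le> (snd (x t))\<^sup>2"
          using sph[of t] eq by simp
        then have "sqrt \<delta> \<le> snd (x t)" using pos'[OF that] by (intro real_le_lsqrt) auto
        then have "\<mu> * sqrt \<delta> \<le> \<mu> * snd (x t)" using \<mu> by (rule mult_left_mono)
        moreover have "\<mu> * sqrt \<delta> = C + \<delta>" using \<open>\<delta> > 0\<close> by (simp add: \<mu>_def)
        ultimately show ?thesis using C(1)[OF st] eq by (simp add: abs_le_iff)
      qed
    qed
    \<comment> \<open>Chosen so that y(0) - \<delta> t = - \<mu> b - \<delta>, which is below the
      bound y > - \<mu> b coming from \<eta> > 0 and s < b.\<close>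
    define t where "t = (y 0 + \<mu> * b) / \<delta> + 1"
    have "y 0 \<ge> 0" using pos s(1) by (simp add: y_def)
    then have t: "t > 0" using \<mu> \<open>0 \<le> b\<close> \<open>\<delta> > 0\<close> by (simp add: t_def add_nonneg_pos)
    have "y t + \<delta> * t \<le> y 0 + \<delta> * 0"
    proof (rule DERIV_nonpos_imp_nonincreasing[where f = "\<lambda>t. y t + \<delta> * t" and a = 0 and b = t])
      fix r :: real assume "0 \<le> r"
      then show "\<exists>z. DERIV (\<lambda>t. y t + \<delta> * t) r :> z \<and> z \<le> 0"
        using y'_le[of r]
        by (intro exI[of _ "- (F (fst (x r)) \<bullet> fst (x r)) - \<mu> * snd (x r) + \<delta>"])
           (auto intro!: derivative_eq_intros y_der)
    qed (use t in auto)
    also have "\<delta> * t = y 0 + \<mu> * b + \<delta>" using \<open>\<delta> > 0\<close> by (simp add: t_def field_simps)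
    finally have "y t < - (\<mu> * b)" using \<open>\<delta> > 0\<close> by simp
    moreover have "\<mu> * s t \<le> \<mu> * b" using s_lt[of t] t \<mu> by (intro mult_left_mono) auto
    ultimately show False using pos'[of t] t by (simp add: y_def)
  qed
  with that show thesis by blast
qed

end

section \<open>The invariant open set of oscillating points\<close>

definition oscillating_points :: "('a \<Rightarrow> 'a) \<Rightarrow> ('a::real_inner \<times> real) set" where
  "oscillating_points F = {x 0 | x. sphere_motion F x \<and> oscillating x}"

context
  fixes F :: "'a::euclidean_space \<Rightarrow> 'a" and K :: real
  assumes lip: "K-lipschitz_on (cball 0 1) F"
begin

text \<open>The negative value after time 0 comes from the exit end of the escaping curve. The one
  before time 0 comes from the entrance end, which is an exit for the field - F along the reversed
  curve \<zeta>(- s).\<close>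

lemma escaping_imp_oscillating:
  assumes x: "sphere_motion F x" and pos: "0 < snd (x 0)" and esc: "escaping F (fst (x 0))"
  shows "oscillating x"
proof -
  obtain a b \<zeta> where ab: "a \<le> 0" "0 \<le> b" and \<zeta>0: "\<zeta> 0 = fst (x 0)"
    and der: "\<And>s. s \<in> {a..b} \<Longrightarrow> (\<zeta> has_vector_derivative F (\<zeta> s)) (at s within {a..b})"
    and inside: "\<And>s. s \<in> {a<..<b} \<Longrightarrow> norm (\<zeta> s) < 1"
    and exit: "norm (\<zeta> a) = 1" "norm (\<zeta> b) = 1" "F (\<zeta> a) \<bullet> \<zeta> a < 0" "0 < F (\<zeta> b) \<bullet> \<zeta> b"
    and in0: "norm (\<zeta> 0) < 1"
    using esc by (auto simp: escaping_def)
  have ab': "a \<noteq> 0" "b \<noteq> 0" using in0 exit by auto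
  obtain t2 where t2: "t2 > 0" "snd (x t2) < 0"
  proof (rule escape_forward[of K F x \<zeta> b])
    show "(\<zeta> has_vector_derivative F (\<zeta> s)) (at s within {0..b})" if "s \<in> {0..b}" for s
      using that ab by (intro has_vector_derivative_within_subset[OF der]) auto
  qed (use inside exit ab ab' lip x pos \<zeta>0 in auto)
  obtain t0 where t0: "t0 > 0" "snd (x (- t0)) < 0"
  proof (rule escape_forward[of K "\<lambda>\<xi>. - F \<xi>" "\<lambda>t. x (- t)" "\<lambda>s. \<zeta> (- s)" "- a"])
    show "((\<lambda>s. \<zeta> (- s)) has_vector_derivative - F (\<zeta> (- s))) (at s within {0..- a})" if "s \<in> {0..- a}" for s
    proof -
      have "(uminus has_vector_derivative -1) (at s within {0..- a})"
        by (auto intro!: derivative_eq_intros)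
      moreover have "(\<zeta> has_vector_derivative F (\<zeta> (- s))) (at (- s) within uminus ` {0..- a})"
        using that ab by (intro has_vector_derivative_within_subset[OF der]) auto
      ultimately show ?thesis
        using vector_diff_chain_within by (fastforce simp: o_def)
    qed
  qed (use inside exit ab ab' pos \<zeta>0 lip sphere_motion_uminus[OF x] in auto)
  show ?thesis
    unfolding oscillating_def using t0 t2 pos
    by (intro exI[of _ "- t0"] exI[of _ 0] exI[of _ t2]) auto
qed

lemma oscillating_points_subset: "oscillating_points F \<subseteq> sphere 0 1"
  by (auto simp: oscillating_points_def sphere_motion_def)

lemma openin_oscillating_points: "openin (top_of_set (sphere 0 1)) (oscillating_points F)"
  unfolding openin_euclidean_subtopology_iff
proof (intro conjI ballI oscillating_points_subset)
  fix p assume "p \<in> oscillating_points F"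
  then obtain x t0 t1 t2 where x: "sphere_motion F x" "x 0 = p"
    and t: "t0 < t1" "t1 < t2" "snd (x t0) < 0" "0 < snd (x t1)" "snd (x t2) < 0"
    by (auto simp: oscillating_points_def oscillating_def)
  obtain M where M: "\<And>y t. sphere_motion F y \<Longrightarrow> dist (y t) (x t) \<le> exp (M * \<bar>t\<bar>) * dist (y 0) p"
    using sphere_motion_dist[OF lip] x by metis
  \<comment> \<open>Dividing by the growth factor exp(M |t|) makes \<eta> change by less than its
    own size at each of the three times, so its signs persist.\<close>
  define e where "e = Min ((\<lambda>t. \<bar>snd (x t)\<bar> / exp (M * \<bar>t\<bar>)) ` {t0, t1, t2})"
  have "e > 0" using t unfolding e_def by (subst Min_gr_iff) (auto simp: divide_less_0_iff intro!: divide_pos_pos)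
  have sgn: "\<bar>snd (y t) - snd (x t)\<bar> < \<bar>snd (x t)\<bar>"
    if "sphere_motion F y" "dist (y 0) p < e" "t \<in> {t0, t1, t2}" for y t
  proof -
    have "\<bar>snd (y t) - snd (x t)\<bar> \<le> dist (y t) (x t)"
      using dist_snd_le[of "y t" "x t"] by (simp add: dist_real_def)
    also have "\<dots> \<le> exp (M * \<bar>t\<bar>) * dist (y 0) p" using M that by blast
    also have "\<dots> < exp (M * \<bar>t\<bar>) * e" using that by simp
    also have "\<dots> \<le> exp (M * \<bar>t\<bar>) * (\<bar>snd (x t)\<bar> / exp (M * \<bar>t\<bar>))"
      unfolding e_def using that(3) by (intro mult_left_mono Min_le) auto
    finally show ?thesis by simp
  qed
  show "\<exists>e>0. \<forall>q\<in>sphere 0 1. dist q p < e \<longrightarrow> q \<in> oscillating_points F"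
  proof (intro exI[of _ e] conjI ballI impI \<open>e > 0\<close>)
    fix q assume q: "q \<in> sphere 0 1" "dist q p < e"
    then obtain y where y: "sphere_motion F y" "y 0 = q" using sphere_motion_exists[OF lip] by blast
    have "oscillating y"
      unfolding oscillating_def
      using t sgn[OF y(1), of t0] sgn[OF y(1), of t1] sgn[OF y(1), of t2] y(2) q(2)
      by (intro exI[of _ t0] exI[of _ t1] exI[of _ t2]) auto
    with y show "q \<in> oscillating_points F" by (auto simp: oscillating_points_def)
  qed
qed

text \<open>By the reflection about a zero b of \<eta>, the motion through \<open>p\<close> passes
  through \<open>flip p\<close> at time 2b, so both points lie on one orbit.\<close>

lemma flip_oscillating_points:
  assumes "p \<in> oscillating_points F"
  shows "flip p \<in> oscillating_points F"
proof -
  obtain x where x: "sphere_motion F x" "oscillating x" "x 0 = p"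
    using assms by (auto simp: oscillating_points_def)
  then obtain a b where "bounce x a b" using oscillating_imp_bounce by blast
  then have "x (b + b) = flip p"
    using sphere_motion_reflect[OF lip x(1), of b b] x(3) by (simp add: bounce_def)
  with sphere_motion_shift[OF x(1), of "b + b"] oscillating_shift[OF x(2), of "b + b"]
  show ?thesis
    unfolding oscillating_points_def by (intro CollectI exI[of _ "\<lambda>t. x (t + (b + b))"]) simp
qed

text \<open>Since |\<xi>| < 1, \<eta> is not 0. The case \<eta> < 0 is carried to \<eta> > 0 by
  \<open>flip\<close>, which leaves \<xi> unchanged.\<close>

lemma escaping_oscillating_point:
  assumes p: "p \<in> sphere 0 1" and esc: "escaping F (fst p)"
  shows "p \<in> oscillating_points F"
proof -
  have *: "p \<in> oscillating_points F" if "p \<in> sphere 0 1" "escaping F (fst p)" "0 < snd p" for p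
  proof -
    obtain x where "sphere_motion F x" "x 0 = p" using sphere_motion_exists[OF lip \<open>p \<in> sphere 0 1\<close>] .
    with that escaping_imp_oscillating show ?thesis by (auto simp: oscillating_points_def)
  qed
  have "norm (fst p) < 1" using esc by (auto simp: escaping_def)
  then have "(norm (fst p))\<^sup>2 < 1" by (simp add: power_less_one_iff)
  then have "snd p \<noteq> 0" using p by (auto simp: norm_prod_def)
  then consider "0 < snd p" | "0 < snd (flip p)" by (fastforce simp: flip_def)
  then show ?thesis
  proof cases
    case 2
    have "flip p \<in> sphere 0 1" "escaping F (fst (flip p))"
      using p esc by (auto simp: flip_def norm_prod_def)
    with 2 have "flip (flip p) \<in> oscillating_points F" by (intro flip_oscillating_points *)
    then show ?thesis by (simp add: flip_def)
  qed (use * assms in blast)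
qed

lemma oscillating_points_nonempty:
  assumes "escaping F \<zeta>"
  shows "oscillating_points F \<noteq> {}"
proof -
  have "norm \<zeta> < 1" using assms by (auto simp: escaping_def)
  then have "(norm \<zeta>)\<^sup>2 \<le> 1" by (simp add: power_le_one)
  then have "(\<zeta>, sqrt (1 - (norm \<zeta>)\<^sup>2)) \<in> sphere 0 1"
    by (simp add: norm_prod_def)
  with escaping_oscillating_point assms show ?thesis by fastforce
qed

text \<open>The lift of \<xi> to a hemisphere by \<eta> = \<plusminus> sqrt(1 - |\<xi>|^2) is
  continuous up to the equator, so escaping points converging to \<xi> lift to oscillating points
  converging to \<open>p\<close>.\<close>

lemma oscillating_points_dense:
  assumes dense: "ball 0 1 \<subseteq> closure {\<zeta> \<in> ball 0 1. escaping F \<zeta>}"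
  shows "sphere 0 1 \<subseteq> closure (oscillating_points F)"
proof
  fix p :: "'a \<times> real" assume p: "p \<in> sphere 0 1"
  obtain \<xi> \<eta> where p_eq: "p = (\<xi>, \<eta>)" by force
  have n: "(norm \<xi>)\<^sup>2 + \<eta>\<^sup>2 = 1" using p by (simp add: p_eq norm_prod_def)
  \<comment> \<open>Selects the hemisphere of \<open>p\<close>; on the equator either sign is
    possible, as the root vanishes there.\<close>
  define \<sigma> :: real where "\<sigma> = (if \<eta> < 0 then -1 else 1)"
  have \<eta>: "\<eta> = \<sigma> * sqrt (1 - (norm \<xi>)\<^sup>2)"
  proof -
    have "1 - (norm \<xi>)\<^sup>2 = \<eta>\<^sup>2" using n by simp
    then show ?thesis by (simp add: \<sigma>_def)
  qed
  have "\<xi> \<in> cball 0 1" using fst_in_cball[of p] p by (simp add: p_eq)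
  also have "\<dots> = closure (ball 0 1)" by simp
  also have "\<dots> \<subseteq> closure {\<zeta> \<in> ball 0 1. escaping F \<zeta>}" using dense by (rule closure_minimal) simp
  finally obtain z where z: "\<And>n. z n \<in> ball 0 1 \<and> escaping F (z n)" "z \<longlonglongrightarrow> \<xi>"
    unfolding closure_sequential by auto
  define q where "q n = (z n, \<sigma> * sqrt (1 - (norm (z n))\<^sup>2))" for n
  have "q \<longlonglongrightarrow> (\<xi>, \<sigma> * sqrt (1 - (norm \<xi>)\<^sup>2))"
    unfolding q_def by (intro tendsto_intros z)
  then have "q \<longlonglongrightarrow> p" by (simp add: p_eq \<eta>)
  moreover have "q n \<in> oscillating_points F" for n
  proof (rule escaping_oscillating_point)
    have "norm (z n) \<le> 1" using z(1)[of n] by simp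
    then have "(norm (z n))\<^sup>2 \<le> 1" by (simp add: power_le_one)
    then show "q n \<in> sphere 0 1" by (simp add: q_def norm_prod_def \<sigma>_def)
    show "escaping F (fst (q n))" using z by (simp add: q_def)
  qed
  ultimately show "p \<in> closure (oscillating_points F)" unfolding closure_sequential by blast
qed

end


section \<open>Smoothness of the motions\<close>

text \<open>The derivative is an existential witness rather than an operator, so each closure rule
  is one induction that exhibits the derivative of the composite curve.\<close>

fun Ck_curve :: "nat \<Rightarrow> (real \<Rightarrow> 'b::real_normed_vector) \<Rightarrow> bool" where
  "Ck_curve 0 c \<longleftrightarrow> continuous_on UNIV c"
| "Ck_curve (Suc k) c \<longleftrightarrow> (\<exists>c'. (\<forall>t. (c has_vector_derivative c' t) (at t)) \<and> Ck_curve k c')"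

lemma Ck_curve_SucI: "(\<And>t. (c has_vector_derivative c' t) (at t)) \<Longrightarrow> Ck_curve k c' \<Longrightarrow> Ck_curve (Suc k) c"
  by auto

declare Ck_curve.simps(2)[simp del]

lemma Ck_curve_pred: "Ck_curve (Suc k) c \<Longrightarrow> Ck_curve k c"
proof (induction k arbitrary: c)
  case 0
  then obtain c' where "\<And>t. (c has_vector_derivative c' t) (at t)"
    by (auto simp: Ck_curve.simps(2))
  then have "continuous (at t) c" for t
    by (rule has_vector_derivative_continuous)
  then show ?case
    by (simp add: continuous_at_imp_continuous_on)
next
  case (Suc k)
  then obtain c' where c': "\<And>t. (c has_vector_derivative c' t) (at t)" "Ck_curve (Suc k) c'"
    by (auto simp: Ck_curve.simps(2))
  show ?case by (rule Ck_curve_SucI[OF c'(1) Suc.IH[OF c'(2)]])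
qed

lemma Ck_curve_const: "Ck_curve k (\<lambda>_. v)"
proof (induction k arbitrary: v)
  case (Suc k)
  then show ?case by (intro Ck_curve_SucI[of _ "\<lambda>_. 0"]) auto
qed simp

lemma Ck_curve_add: "Ck_curve k c \<Longrightarrow> Ck_curve k d \<Longrightarrow> Ck_curve k (\<lambda>t. c t + d t)"
proof (induction k arbitrary: c d)
  case 0
  then show ?case by (auto intro: continuous_intros)
next
  case (Suc k)
  then obtain c' d' where
    "\<And>t. (c has_vector_derivative c' t) (at t)" "Ck_curve k c'"
    "\<And>t. (d has_vector_derivative d' t) (at t)" "Ck_curve k d'"
    unfolding Ck_curve.simps by blast
  with Suc.IH show ?case
    by (intro Ck_curve_SucI[of _ "\<lambda>t. c' t + d' t"]) (auto intro: has_vector_derivative_add)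
qed

lemma Ck_curve_sum:
  "finite A \<Longrightarrow> (\<And>i. i \<in> A \<Longrightarrow> Ck_curve k (c i)) \<Longrightarrow> Ck_curve k (\<lambda>t. \<Sum>i\<in>A. c i t)"
  by (induction A rule: finite_induct) (auto intro: Ck_curve_const Ck_curve_add)

lemma Ck_curve_bounded_bilinear:
  assumes "bounded_bilinear B"
  shows "Ck_curve k c \<Longrightarrow> Ck_curve k d \<Longrightarrow> Ck_curve k (\<lambda>t. B (c t) (d t))"
proof (induction k arbitrary: c d)
  case 0
  then show ?case by (auto intro: bounded_bilinear.continuous_on[OF assms])
next
  case (Suc k)
  obtain c' where c': "\<And>t. (c has_vector_derivative c' t) (at t)" "Ck_curve k c'"
    using Suc.prems(1) unfolding Ck_curve.simps by blast
  obtain d' where d': "\<And>t. (d has_vector_derivative d' t) (at t)" "Ck_curve k d'"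
    using Suc.prems(2) unfolding Ck_curve.simps by blast
  show ?case
    by (rule Ck_curve_SucI[OF bounded_bilinear.has_vector_derivative[OF assms c'(1) d'(1)]])
       (rule Ck_curve_add[OF Suc.IH[OF Ck_curve_pred[OF Suc.prems(1)] d'(2)]
          Suc.IH[OF c'(2) Ck_curve_pred[OF Suc.prems(2)]]])
qed

lemmas Ck_curve_scaleR = Ck_curve_bounded_bilinear[OF bounded_bilinear_scaleR]
lemmas Ck_curve_inner = Ck_curve_bounded_bilinear[OF bounded_bilinear_inner]

lemma Ck_curve_bounded_linear:
  assumes "bounded_linear f"
  shows "Ck_curve k c \<Longrightarrow> Ck_curve k (\<lambda>t. f (c t))"
proof (induction k arbitrary: c)
  case 0
  then show ?case by (auto intro: bounded_linear.continuous_on[OF assms])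
next
  case (Suc k)
  then obtain c' where c': "\<And>t. (c has_vector_derivative c' t) (at t)" "Ck_curve k c'"
    unfolding Ck_curve.simps by blast
  show ?case
    by (rule Ck_curve_SucI[OF bounded_linear.has_vector_derivative[OF assms c'(1)] Suc.IH[OF c'(2)]])
qed

lemmas Ck_curve_fst = Ck_curve_bounded_linear[OF bounded_linear_fst]
lemmas Ck_curve_snd = Ck_curve_bounded_linear[OF bounded_linear_snd]
lemmas Ck_curve_uminus = Ck_curve_bounded_linear[OF bounded_linear_minus[OF bounded_linear_ident]]

lemma Ck_curve_Pair:
  assumes "Ck_curve k c" "Ck_curve k d"
  shows "Ck_curve k (\<lambda>t. (c t, d t))"
proof -
  have "Ck_curve k (\<lambda>t. (c t, 0) + (0, d t))"
    by (intro Ck_curve_add Ck_curve_bounded_linear[of "\<lambda>x. (x, 0)"] Ck_curve_bounded_linear[of "\<lambda>x. (0, x)"]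
        bounded_linear_Pair bounded_linear_ident bounded_linear_zero assms)
  then show ?thesis by simp
qed

lemma Ck_curve_compose:
  "Ck_curve k c \<Longrightarrow> Ck_curve k u \<Longrightarrow> Ck_curve k (\<lambda>t. c (u t))"
proof (induction k arbitrary: c u)
  case 0
  then show ?case using continuous_on_compose2[of UNIV c UNIV u] by simp
next
  case (Suc k)
  obtain c' where c': "\<And>t. (c has_vector_derivative c' t) (at t)" "Ck_curve k c'"
    using Suc.prems(1) unfolding Ck_curve.simps by blast
  obtain u' where u': "\<And>t. (u has_vector_derivative u' t) (at t)" "Ck_curve k u'"
    using Suc.prems(2) unfolding Ck_curve.simps by blast
  have "((\<lambda>t. c (u t)) has_vector_derivative u' t *\<^sub>R c' (u t)) (at t)" for t
    using vector_diff_chain_at[OF u'(1) c'(1)] by (simp add: o_def)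
  then show ?case
    by (rule Ck_curve_SucI[OF _ Ck_curve_scaleR[OF u'(2) Suc.IH[OF c'(2) Ck_curve_pred[OF Suc.prems(2)]]]])
qed

lemma has_derivative_frechet_basis:
  fixes f :: "'a::euclidean_space \<Rightarrow> 'b::real_normed_vector"
  assumes "f differentiable (at x)"
  shows "(f has_derivative (\<lambda>v. \<Sum>i\<in>Basis. (v \<bullet> i) *\<^sub>R frechet_derivative f (at x) i)) (at x)"
proof -
  have D: "(f has_derivative frechet_derivative f (at x)) (at x)"
    using assms by (simp add: frechet_derivative_works)
  have "frechet_derivative f (at x) v = (\<Sum>i\<in>Basis. (v \<bullet> i) *\<^sub>R frechet_derivative f (at x) i)" for v
    using linear_sum[OF has_derivative_linear[OF D], of "\<lambda>i. (v \<bullet> i) *\<^sub>R i" Basis]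
    by (simp add: euclidean_representation linear_cmul[OF has_derivative_linear[OF D]])
  then have "frechet_derivative f (at x) = (\<lambda>v. \<Sum>i\<in>Basis. (v \<bullet> i) *\<^sub>R frechet_derivative f (at x) i)"
    by (rule ext)
  with D show ?thesis by simp
qed

text \<open>Only derivatives in fixed directions are available from \<^const>\<open>C_k_on\<close>, hence the expansion in a basis.\<close>

lemma Ck_curve_C_k_on:
  fixes f :: "'a::euclidean_space \<Rightarrow> 'b::real_normed_vector"
  shows "C_k_on k W f \<Longrightarrow> (\<And>t. c t \<in> W) \<Longrightarrow> Ck_curve k c \<Longrightarrow> Ck_curve k (\<lambda>t. f (c t))"
proof (induction k arbitrary: f)
  case 0
  then show ?case using continuous_on_compose2[of W f UNIV c] by auto
next
  case (Suc k)
  obtain c' where c': "\<And>t. (c has_vector_derivative c' t) (at t)" "Ck_curve k c'"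
    using Suc.prems(3) unfolding Ck_curve.simps by blast
  show ?case
  proof (rule Ck_curve_SucI)
    fix t
    have "(f has_derivative (\<lambda>v. \<Sum>i\<in>Basis. (v \<bullet> i) *\<^sub>R frechet_derivative f (at (c t)) i)) (at (c t))"
      using Suc.prems by (intro has_derivative_frechet_basis) auto
    from has_derivative_compose[OF c'(1)[unfolded has_vector_derivative_def] this]
    show "((\<lambda>t. f (c t)) has_vector_derivative (\<Sum>i\<in>Basis. (c' t \<bullet> i) *\<^sub>R frechet_derivative f (at (c t)) i)) (at t)"
      by (simp add: has_vector_derivative_def scaleR_sum_right)
  next
    have "Ck_curve k (\<lambda>t. frechet_derivative f (at (c t)) i)" for i
      using Suc.prems(1) by (intro Suc.IH Suc.prems(2) Ck_curve_pred[OF Suc.prems(3)]) simp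
    then show "Ck_curve k (\<lambda>t. \<Sum>i\<in>Basis. (c' t \<bullet> i) *\<^sub>R frechet_derivative f (at (c t)) i)"
      by (intro Ck_curve_sum Ck_curve_scaleR Ck_curve_inner[OF c'(2) Ck_curve_const]) auto
  qed
qed

text \<open>The operator norm of the derivative is at most the sum of its norms on the basis
  vectors, which is continuous and hence bounded on the compact set \<open>S\<close>; convexity
  turns this bound into a Lipschitz constant.\<close>

lemma smooth_on_imp_lipschitz:
  fixes F :: "'a::euclidean_space \<Rightarrow> 'b::real_normed_vector"
  assumes "smooth_on S F" and S: "convex S" "compact S"
  obtains K where "K-lipschitz_on S F"
proof -
  obtain W G where W: "S \<subseteq> W" "\<And>x. x \<in> S \<Longrightarrow> G x = F x" and "C_k_on 1 W G"
    using assms(1) unfolding smooth_on_def by metis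
  then have G: "\<And>x. x \<in> W \<Longrightarrow> G differentiable (at x)"
    "\<And>v. continuous_on W (\<lambda>x. frechet_derivative G (at x) v)"
    by auto
  define g where "g x = (\<Sum>i\<in>Basis. norm (frechet_derivative G (at x) i))" for x
  have "continuous_on S g"
    unfolding g_def by (intro continuous_intros continuous_on_subset[OF G(2) W(1)])
  then have "bounded (g ` S)"
    using S(2) by (intro compact_imp_bounded compact_continuous_image)
  then obtain B where "\<And>x. x \<in> S \<Longrightarrow> \<bar>g x\<bar> \<le> B"
    by (fastforce simp: bounded_iff)
  then have B: "g x \<le> \<bar>B\<bar>" if "x \<in> S" for x
    using that by (meson abs_ge_self order_trans)
  have "\<bar>B\<bar>-lipschitz_on S G"
  proof (rule bounded_derivative_imp_lipschitz)
    fix x assume x: "x \<in> S"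
    then have D: "(G has_derivative frechet_derivative G (at x)) (at x)"
      using G(1) W(1) by (auto simp: frechet_derivative_works)
    then show "(G has_derivative frechet_derivative G (at x)) (at x within S)"
      by (rule has_derivative_at_withinI)
    have "onorm (frechet_derivative G (at x)) \<le> g x"
      unfolding g_def by (rule onorm_componentwise[OF has_derivative_bounded_linear[OF D]])
    with B[OF x] show "onorm (frechet_derivative G (at x)) \<le> \<bar>B\<bar>" by simp
  qed (use S in auto)
  then have "\<bar>B\<bar>-lipschitz_on S F"
    using W(2) by (auto simp: lipschitz_on_def)
  then show thesis by (rule that)
qed

text \<open>Bootstrapping: if the motion is C^k, so is the field along it, which is its derivative.
  The smooth extension \<open>G\<close> replaces \<open>F\<close>, as \<open>C_k_on\<close> refers
  to derivatives in an open set.\<close>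

lemma Ck_curve_sphere_motion:
  fixes F :: "'a::euclidean_space \<Rightarrow> 'a"
  assumes "smooth_on (cball 0 1) F" and x: "sphere_motion F x"
  shows "Ck_curve k x"
proof -
  obtain W G where W: "cball 0 1 \<subseteq> W" "\<And>\<xi>. \<xi> \<in> cball 0 1 \<Longrightarrow> G \<xi> = F \<xi>" and G: "\<And>k. C_k_on k W G"
    using assms(1) unfolding smooth_on_def by metis
  have in_ball: "fst (x t) \<in> cball 0 1" for t
    using x by (intro fst_in_cball) (auto simp: sphere_motion_def)
  show ?thesis
  proof (induction k)
    case 0
    then show ?case using continuous_on_sphere_motion[OF x] by simp
  next
    case (Suc k)
    have G_fst: "Ck_curve k (\<lambda>t. G (fst (x t)))"
      using in_ball W(1) by (intro Ck_curve_C_k_on[OF G] Ck_curve_fst[OF Suc.IH]) auto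
    have "Ck_curve k (\<lambda>t. (snd (x t) *\<^sub>R G (fst (x t)), - (G (fst (x t)) \<bullet> fst (x t))))"
      by (intro Ck_curve_Pair Ck_curve_scaleR[OF Ck_curve_snd[OF Suc.IH] G_fst]
          Ck_curve_uminus Ck_curve_inner[OF G_fst Ck_curve_fst[OF Suc.IH]])
    then have "Ck_curve k (\<lambda>t. sphere_field F (x t))"
      using W(2)[OF in_ball] by (simp add: sphere_field_def)
    moreover have "(x has_vector_derivative sphere_field F (x t)) (at t)" for t
      using x by (simp add: sphere_motion_def)
    ultimately show ?case by (rule Ck_curve_SucI[rotated])
  qed
qed

section \<open>Convergence and smoothness of the operator exponential\<close>

context
  fixes L :: "'a::euclidean_space \<Rightarrow> 'a"
  assumes L: "linear L"
begin

lemma linear_funpow: "linear (L ^^ k)"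
proof (induction k)
  case 0
  show ?case by (simp add: linear_iff)
next
  case (Suc k)
  show ?case using linear_compose[OF Suc L] by (simp add: o_def)
qed

lemma exp_op_summable: "summable (\<lambda>k. (u ^ k / fact k) *\<^sub>R (L ^^ k) v)"
proof -
  obtain B where B: "B > 0" "\<And>x. norm (L x) \<le> norm x * B"
    using bounded_linear.pos_bounded[OF linear_conv_bounded_linear[THEN iffD1, OF L]] by auto
  have le: "norm ((L ^^ k) v) \<le> B ^ k * norm v" for k
  proof (induction k)
    case (Suc k)
    have "norm ((L ^^ Suc k) v) \<le> norm ((L ^^ k) v) * B" using B(2) by simp
    also have "\<dots> \<le> B ^ k * norm v * B" using Suc B(1) by (intro mult_right_mono) auto
    finally show ?case by (simp add: mult_ac)
  qed simp
  have "summable (\<lambda>k. (inverse (fact k) * (\<bar>u\<bar> * B) ^ k) * norm v)"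
    by (intro summable_mult2 summable_exp)
  then show ?thesis
  proof (rule summable_comparison_test'[where N = 0])
    fix k
    have "norm ((u ^ k / fact k) *\<^sub>R (L ^^ k) v) = (\<bar>u\<bar> ^ k / fact k) * norm ((L ^^ k) v)"
      by (simp add: power_abs)
    also have "\<dots> \<le> (\<bar>u\<bar> ^ k / fact k) * (B ^ k * norm v)"
      by (intro mult_left_mono le) auto
    finally show "norm ((u ^ k / fact k) *\<^sub>R (L ^^ k) v) \<le> (inverse (fact k) * (\<bar>u\<bar> * B) ^ k) * norm v"
      by (simp add: power_mult_distrib divide_inverse mult_ac)
  qed
qed

lemma exp_op_0: "exp_op L 0 v = v"
proof -
  have "(\<lambda>k. (0 ^ k / fact k) *\<^sub>R (L ^^ k) v) = (\<lambda>k. if k = 0 then v else 0)"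
    by (auto simp: fun_eq_iff)
  then show ?thesis
    unfolding exp_op_def using sums_single[of 0 "\<lambda>_. v"] by (simp add: sums_iff)
qed

text \<open>Reduces the exponential applied to a moving vector to scalar coefficients times the
  exponential of fixed vectors, so that only curves in \<open>u\<close> have to be
  differentiated.\<close>

lemma exp_op_basis: "exp_op L u v = (\<Sum>i\<in>Basis. (v \<bullet> i) *\<^sub>R exp_op L u i)"
proof -
  have "(L ^^ k) v = (\<Sum>i\<in>Basis. (v \<bullet> i) *\<^sub>R (L ^^ k) i)" for k
    using linear_sum[OF linear_funpow, of k "\<lambda>i. (v \<bullet> i) *\<^sub>R i" Basis]
    by (simp add: euclidean_representation linear_cmul[OF linear_funpow])
  then have "exp_op L u v = (\<Sum>k. \<Sum>i\<in>Basis. (v \<bullet> i) *\<^sub>R ((u ^ k / fact k) *\<^sub>R (L ^^ k) i))"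
    unfolding exp_op_def by (simp add: scaleR_sum_right mult_ac)
  also have "\<dots> = (\<Sum>i\<in>Basis. \<Sum>k. (v \<bullet> i) *\<^sub>R ((u ^ k / fact k) *\<^sub>R (L ^^ k) i))"
    by (intro suminf_sum summable_scaleR_right exp_op_summable)
  also have "\<dots> = (\<Sum>i\<in>Basis. (v \<bullet> i) *\<^sub>R exp_op L u i)"
    unfolding exp_op_def by (intro sum.cong refl suminf_scaleR_right[symmetric] exp_op_summable)
  finally show ?thesis .
qed

text \<open>Each component is an everywhere convergent scalar power series in u. Termwise
  differentiation shifts the coefficients of \<open>v\<close> to those of
  \<open>L v\<close>.\<close>

lemma exp_op_has_vector_derivative:
  "((\<lambda>u. exp_op L u v) has_vector_derivative exp_op L u (L v)) (at u)"
  unfolding has_vector_derivative_def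
proof (subst has_derivative_componentwise_within, intro ballI)
  fix i :: 'a
  define c where "c v k = ((L ^^ k) v \<bullet> i) / fact k" for v k
  have series: "summable (\<lambda>k. c v k * u ^ k)" "exp_op L u v \<bullet> i = (\<Sum>k. c v k * u ^ k)" for u v
    using bounded_linear.summable[OF bounded_linear_inner_left exp_op_summable[of u v], of i]
      bounded_linear.suminf[OF bounded_linear_inner_left exp_op_summable[of u v], of i]
    by (auto simp: c_def exp_op_def mult_ac)
  have "diffs (c v) = c (L v)"
    by (auto simp: fun_eq_iff diffs_def c_def funpow_swap1 simp del: of_nat_Suc)
  with termdiffs_strong_converges_everywhere[OF series(1)[of v], of u]
  have "DERIV (\<lambda>u. exp_op L u v \<bullet> i) u :> exp_op L u (L v) \<bullet> i"
    by (simp add: series(2))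
  then show "((\<lambda>u. exp_op L u v \<bullet> i) has_derivative (\<lambda>x. (x *\<^sub>R exp_op L u (L v)) \<bullet> i)) (at u)"
    by (simp add: has_field_derivative_def mult_commute_abs)
qed

lemma Ck_curve_exp_op_const: "Ck_curve k (\<lambda>u. exp_op L u v)"
proof (induction k arbitrary: v)
  case 0
  then show ?case
    using has_vector_derivative_continuous[OF exp_op_has_vector_derivative]
    by (simp add: continuous_at_imp_continuous_on)
next
  case (Suc k)
  then show ?case by (rule Ck_curve_SucI[OF exp_op_has_vector_derivative])
qed

lemma Ck_curve_exp_op:
  assumes "Ck_curve k u" "Ck_curve k c"
  shows "Ck_curve k (\<lambda>t. exp_op L (u t) (c t))"
proof -
  have "Ck_curve k (\<lambda>t. \<Sum>i\<in>Basis. (c t \<bullet> i) *\<^sub>R exp_op L (u t) i)"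
    by (intro Ck_curve_sum[OF finite_Basis] Ck_curve_scaleR
        Ck_curve_inner[OF assms(2) Ck_curve_const] Ck_curve_compose[OF Ck_curve_exp_op_const assms(1)])
  then show ?thesis by (simp flip: exp_op_basis)
qed

end

section \<open>Maps that are linear in all angles except the last\<close>

lemma has_vector_derivative_angle:
  fixes c :: "real \<Rightarrow> 'b::real_normed_vector" and n :: nat
  assumes "i \<le> n" "(c has_vector_derivative c') (at (\<theta> n))"
  shows "((\<lambda>h. (\<Sum>j<n. (\<theta>(i := h)) j *\<^sub>R v j) + c ((\<theta>(i := h)) n)) has_vector_derivative
           (if i < n then v i else c')) (at (\<theta> i))"
proof -
  have "((\<lambda>h. (\<theta>(i := h)) j *\<^sub>R v j) has_vector_derivative (if j = i then v j else 0)) (at (\<theta> i))" for j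
    by (cases "j = i") (auto simp: has_vector_derivative_def intro!: derivative_eq_intros)
  then have 1: "((\<lambda>h. \<Sum>j<n. (\<theta>(i := h)) j *\<^sub>R v j) has_vector_derivative (\<Sum>j<n. if j = i then v j else 0)) (at (\<theta> i))"
    by (intro has_vector_derivative_sum)
  have sum_eq: "(\<Sum>j<n. if j = i then v j else 0) = (if i < n then v i else 0)"
    by (simp add: sum.delta)
  have 2: "((\<lambda>h. c ((\<theta>(i := h)) n)) has_vector_derivative (if i = n then c' else 0)) (at (\<theta> i))"
    using assms(2) by (cases "i = n") auto
  show ?thesis
    using has_vector_derivative_add[OF 1 2] assms(1) unfolding sum_eq
    by (cases "i < n") (simp_all del: fun_upd_apply)
qed

lemma partial_deriv_angle:
  fixes c :: "real \<Rightarrow> 'b::real_normed_vector" and n :: nat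
  assumes "i \<le> n" "\<And>t. (c has_vector_derivative c' t) (at t)"
  shows "partial_deriv i (\<lambda>\<theta>. (\<Sum>j<n. \<theta> j *\<^sub>R v j) + c (\<theta> n)) \<theta> = (if i < n then v i else c' (\<theta> n))"
  unfolding partial_deriv_def
  by (rule vector_derivative_at) (rule has_vector_derivative_angle[OF assms])

lemma continuous_on_angles:
  fixes c :: "real \<Rightarrow> 'b::real_normed_vector" and n :: nat
  assumes "continuous_on UNIV c"
  shows "continuous_on UNIV (\<lambda>\<theta>. (\<Sum>j<n. \<theta> j *\<^sub>R v j) + c (\<theta> n))"
proof -
  have 1: "continuous_on UNIV (\<lambda>\<theta> :: nat \<Rightarrow> real. \<theta> j *\<^sub>R v j)" for j
    by (rule continuous_on_scaleR[OF continuous_on_product_coordinates continuous_on_const])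
  have 2: "continuous_on UNIV (\<lambda>\<theta>. c (\<theta> n))"
    by (rule continuous_on_compose2[OF assms continuous_on_product_coordinates subset_UNIV])
  show ?thesis
    by (rule continuous_on_add[OF continuous_on_sum[OF 1] 2])
qed

text \<open>Every partial derivative has the same form, with zero vectors in the linear part and
  \<open>c\<close> replaced by a constant or by its derivative; so the induction on \<open>m\<close>
  closes.\<close>

lemma C_m_angles_curve:
  "Ck_curve m c \<Longrightarrow> C_m_angles (Suc n) m (\<lambda>\<theta>. (\<Sum>j<n. \<theta> j *\<^sub>R v j) + c (\<theta> n))"
proof (induction m arbitrary: c v)
  case 0
  then show ?case
    by (simp add: continuous_on_angles)
next
  case (Suc m)
  then obtain c' where c': "\<And>t. (c has_vector_derivative c' t) (at t)" "Ck_curve m c'"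
    unfolding Ck_curve.simps by blast
  have cont: "continuous_on UNIV c"
    by (intro continuous_at_imp_continuous_on ballI has_vector_derivative_continuous[OF c'(1)])
  show ?case
    unfolding C_m_angles.simps
  proof (intro conjI allI impI)
    show "continuous_on UNIV (\<lambda>\<theta>. (\<Sum>j<n. \<theta> j *\<^sub>R v j) + c (\<theta> n))"
      by (rule continuous_on_angles[OF cont])
    fix i assume i: "i < Suc n"
    show "(\<lambda>h. (\<Sum>j<n. (\<theta>(i := h)) j *\<^sub>R v j) + c ((\<theta>(i := h)) n)) differentiable at (\<theta> i)" for \<theta>
      by (rule differentiableI_vector[OF has_vector_derivative_angle[OF _ c'(1)]]) (use i in simp)
    have "partial_deriv i (\<lambda>\<theta>. (\<Sum>j<n. \<theta> j *\<^sub>R v j) + c (\<theta> n)) = (\<lambda>\<theta>. if i < n then v i else c' (\<theta> n))"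
      using i by (intro ext partial_deriv_angle c') simp
    also have "\<dots> = (\<lambda>\<theta>. (\<Sum>j<n. \<theta> j *\<^sub>R 0) + (if i < n then \<lambda>_. v i else c') (\<theta> n))"
      by auto
    finally have eq: "partial_deriv i (\<lambda>\<theta>. (\<Sum>j<n. \<theta> j *\<^sub>R v j) + c (\<theta> n)) =
      (\<lambda>\<theta>. (\<Sum>j<n. \<theta> j *\<^sub>R 0) + (if i < n then \<lambda>_. v i else c') (\<theta> n))" .
    have "Ck_curve m (if i < n then \<lambda>_. v i else c')"
      using c'(2) by (simp add: Ck_curve_const)
    from Suc.IH[OF this] show "C_m_angles (Suc n) m (partial_deriv i (\<lambda>\<theta>. (\<Sum>j<n. \<theta> j *\<^sub>R v j) + c (\<theta> n)))"
      unfolding eq .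
  qed
qed


section \<open>Lattices, tori and the quotient\<close>

lemma cis_eq_iff: "cis a = cis b \<longleftrightarrow> (a - b) / (2 * pi) \<in> \<int>"
proof -
  have "cis a = cis b \<longleftrightarrow> (\<exists>m::int. a = b + 2 * pi * m)"
    using sin_cos_eq_iff[of a b] by (auto simp: complex_eq_iff)
  also have "\<dots> \<longleftrightarrow> (\<exists>m::int. (a - b) / (2 * pi) = m)"
    by (auto simp: field_simps)
  finally show ?thesis by (auto simp: Ints_def)
qed

lemma topspace_torus: "z \<in> topspace (torus k) \<longleftrightarrow> z \<in> extensional {..<k} \<and> (\<forall>i<k. norm (z i) = 1)"
  by (auto simp: torus_def PiE_def)

lemma torus_angle_in_torus: "torus_angle k \<theta> \<in> topspace (torus k)"
  by (auto simp: topspace_torus torus_angle_def)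

lemma torus_angle_eq_iff:
  "torus_angle k \<theta> = torus_angle k \<theta>' \<longleftrightarrow> (\<forall>i<k. (\<theta> i - \<theta>' i) / (2 * pi) \<in> \<int>)"
  unfolding cis_eq_iff[symmetric] torus_angle_def fun_eq_iff by (auto simp: restrict_def)

lemma torus_angle_Arg:
  assumes "z \<in> topspace (torus k)"
  shows "torus_angle k (\<lambda>i. Arg (z i)) = z"
proof
  fix i
  have z: "z \<in> extensional {..<k}" "\<And>i. i < k \<Longrightarrow> norm (z i) = 1"
    using assms by (auto simp: topspace_torus)
  show "torus_angle k (\<lambda>i. Arg (z i)) i = z i"
  proof (cases "i < k")
    case True
    then have "z i \<noteq> 0" using z(2)[of i] by auto
    with True z(2)[of i] show ?thesis by (simp add: torus_angle_def cis_Arg sgn_eq)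
  next
    case False
    with z(1) show ?thesis by (simp add: torus_angle_def extensional_def)
  qed
qed

lemma linear_flow_torus_angle:
  "linear_flow k \<omega> t (torus_angle k \<theta>) = torus_angle k (\<lambda>i. \<theta> i + t * \<omega> i)"
  by (auto simp: linear_flow_def torus_angle_def fun_eq_iff restrict_def cis_mult add.commute)

lemma compact_space_torus: "compact_space (torus k)"
  unfolding torus_def by (simp add: compact_space_product_topology compact_space_subtopology)

lemma Hausdorff_space_torus: "Hausdorff_space (torus k)"
  unfolding torus_def by (simp add: Hausdorff_space_product_topology Hausdorff_space_subtopology)

text \<open>Lets continuity on the torus be tested in angle coordinates. All coordinates, also those
  from \<open>k\<close> on, are confined to [-pi, pi], so that the domain is compact by Tychonoff; a
  continuous surjection from a compact space onto a Hausdorff space is a quotient map.\<close>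

lemma quotient_map_torus_angle:
  "quotient_map (top_of_set {\<theta>. \<forall>i. \<theta> i \<in> {-pi..pi}}) (torus k) (torus_angle k)"
proof (rule continuous_imp_quotient_map)
  let ?K = "{\<theta> :: nat \<Rightarrow> real. \<forall>i. \<theta> i \<in> {-pi..pi}}"
  have "continuous_on ?K (\<lambda>\<theta>. cis (\<theta> i))" for i
    by (intro continuous_on_cis continuous_on_subset[OF continuous_on_product_coordinates subset_UNIV])
  then show "continuous_map (top_of_set ?K) (torus k) (torus_angle k)"
    unfolding torus_def continuous_map_componentwise
    by (auto simp: torus_angle_def continuous_map_in_subtopology)
  have "compactin (product_topology (\<lambda>_. euclidean) UNIV) (PiE UNIV (\<lambda>_::nat. {-pi..pi}))"
    by (simp add: compactin_PiE)
  moreover have "PiE UNIV (\<lambda>_::nat. {-pi..pi}) = ?K" by auto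
  ultimately show "compact_space (top_of_set ?K)"
    by (simp add: euclidean_product_topology compact_space_subtopology)
  show "Hausdorff_space (torus k)" by (rule Hausdorff_space_torus)
  have "\<exists>\<theta>\<in>?K. z = torus_angle k \<theta>" if "z \<in> topspace (torus k)" for z
    using torus_angle_Arg[OF that] Arg_bounded
    by (intro bexI[of _ "\<lambda>i. Arg (z i)"]) (auto intro: less_imp_le)
  then show "torus_angle k ` topspace (top_of_set ?K) = topspace (torus k)"
    using torus_angle_in_torus by auto
qed

text \<open>\<open>co\<close> is the dual basis of a lattice basis \<open>b\<close>. Congruence
  modulo \<Gamma> becomes integrality of coordinate differences, the same condition that governs
  equality of torus angles divided by 2 pi.\<close>

locale lattice_coords =
  fixes \<Gamma> :: "'a::euclidean_space set" and n :: nat and b :: "nat \<Rightarrow> 'a" and co :: "nat \<Rightarrow> 'a \<Rightarrow> real"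
  assumes linear_co: "linear (co i)"
    and co_basis: "i < n \<Longrightarrow> j < n \<Longrightarrow> co i (b j) = (if i = j then 1 else 0)"
    and expansion: "(\<Sum>i<n. co i w *\<^sub>R b i) = w"
    and lattice_iff: "w \<in> \<Gamma> \<longleftrightarrow> (\<forall>i<n. co i w \<in> \<int>)"

lemma full_rank_lattice_coords:
  fixes \<Gamma> :: "'a::euclidean_space set"
  assumes "full_rank_lattice \<Gamma>"
  obtains n b co where "lattice_coords \<Gamma> n b co"
proof -
  obtain B where B: "finite B" "independent B" "span B = UNIV"
    and \<Gamma>: "\<Gamma> = {\<Sum>v\<in>B. of_int (c v) *\<^sub>R v | c :: 'a \<Rightarrow> int. True}"
    using assms by (auto simp: full_rank_lattice_def)
  obtain b where b: "bij_betw b {..<card B} B"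
    using ex_bij_betw_nat_finite[OF B(1)] by (auto simp: atLeast0LessThan)
  define co where "co i w = representation B w (b i)" for i w
  have b_in: "b i \<in> B" if "i < card B" for i using b that by (auto simp: bij_betw_def)
  have sum_b: "(\<Sum>v\<in>B. f v) = (\<Sum>i<card B. f (b i))" for f :: "'a \<Rightarrow> 'a"
    by (rule sum.reindex_bij_betw[OF b, symmetric])
  have lin: "linear (co i)" for i
    using B by (intro linearI) (auto simp: co_def representation_add representation_scale)
  have basis: "co i (b j) = (if i = j then 1 else 0)" if "i < card B" "j < card B" for i j
    using that b representation_basis[OF B(2) b_in[OF that(2)]]
    by (auto simp: co_def bij_betw_def dest: inj_onD)
  have exp: "(\<Sum>i<card B. co i w *\<^sub>R b i) = w" for w
    using sum_representation_eq[OF B(2), of w B] B unfolding co_def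
    by (simp add: sum_b)
  have "w \<in> \<Gamma> \<longleftrightarrow> (\<forall>i<card B. co i w \<in> \<int>)" for w
  proof
    assume "w \<in> \<Gamma>"
    then obtain c :: "'a \<Rightarrow> int" where w: "w = (\<Sum>i<card B. of_int (c (b i)) *\<^sub>R b i)"
      by (auto simp: \<Gamma> sum_b)
    have "co i w = of_int (c (b i))" if "i < card B" for i
    proof -
      have "co i w = (\<Sum>j<card B. of_int (c (b j)) * co i (b j))"
        unfolding w by (simp add: linear_sum[OF lin] linear_cmul[OF lin])
      also have "\<dots> = (\<Sum>j<card B. if j = i then of_int (c (b i)) else 0)"
        using basis that by (intro sum.cong) auto
      finally show ?thesis using that by simp
    qed
    then show "\<forall>i<card B. co i w \<in> \<int>" by simp
  next
    assume *: "\<forall>i<card B. co i w \<in> \<int>"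
    define c where "c v = \<lfloor>representation B w v\<rfloor>" for v
    have "of_int (c (b i)) = co i w" if "i < card B" for i
    proof -
      have "co i w \<in> \<int>" using * that by blast
      then show ?thesis by (auto elim!: Ints_cases simp: c_def co_def)
    qed
    then have "(\<Sum>v\<in>B. of_int (c v) *\<^sub>R v) = (\<Sum>i<card B. co i w *\<^sub>R b i)"
      unfolding sum_b by (intro sum.cong) auto
    then have "w = (\<Sum>v\<in>B. of_int (c v) *\<^sub>R v)"
      by (simp only: exp)
    then show "w \<in> \<Gamma>" by (auto simp: \<Gamma>)
  qed
  with lin basis exp have "lattice_coords \<Gamma> (card B) b co"
    by (simp add: lattice_coords_def)
  then show thesis by (rule that)
qed

context lattice_coords
begin

lemma co_combination: "i < n \<Longrightarrow> co i (\<Sum>j<n. a j *\<^sub>R b j) = a i"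
proof -
  assume i: "i < n"
  have "co i (\<Sum>j<n. a j *\<^sub>R b j) = (\<Sum>j<n. a j * co i (b j))"
    by (simp add: linear_sum[OF linear_co] linear_cmul[OF linear_co])
  also have "\<dots> = (\<Sum>j<n. if j = i then a i else 0)"
    using i by (intro sum.cong) (auto simp: co_basis)
  finally show ?thesis using i by simp
qed

lemma coset_M_mem:
  assumes "linear L"
  shows "(p, v) \<in> coset_M L \<Gamma> (w, u) \<longleftrightarrow> v = u \<and> (\<forall>i<n. co i p - co i w \<in> \<int>)"
proof -
  have "(p, v) \<in> coset_M L \<Gamma> (w, u) \<longleftrightarrow> v = u \<and> p - w \<in> \<Gamma>"
    by (auto simp: coset_M_def exp_op_0[OF assms] image_iff algebra_simps intro!: bexI[of _ "p - w"])
  then show ?thesis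
    by (simp add: lattice_iff linear_diff[OF linear_co])
qed

lemma coset_M_eq_iff:
  assumes "linear L"
  shows "coset_M L \<Gamma> (w, u) = coset_M L \<Gamma> (w', u') \<longleftrightarrow> u = u' \<and> (\<forall>i<n. co i w - co i w' \<in> \<int>)"
proof
  assume "coset_M L \<Gamma> (w, u) = coset_M L \<Gamma> (w', u')"
  moreover have "(w, u) \<in> coset_M L \<Gamma> (w, u)" by (simp add: coset_M_mem[OF assms])
  ultimately show "u = u' \<and> (\<forall>i<n. co i w - co i w' \<in> \<int>)" by (simp add: coset_M_mem[OF assms])
next
  assume *: "u = u' \<and> (\<forall>i<n. co i w - co i w' \<in> \<int>)"
  have "co i p - co i w \<in> \<int> \<longleftrightarrow> co i p - co i w' \<in> \<int>" if "i < n" for p i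
  proof -
    have "co i w - co i w' \<in> \<int>" using * that by simp
    from Ints_add[OF _ this, of "co i p - co i w"] Ints_diff[OF _ this, of "co i p - co i w'"]
    show ?thesis by auto
  qed
  with * show "coset_M L \<Gamma> (w, u) = coset_M L \<Gamma> (w', u')"
    by (auto simp: coset_M_mem[OF assms] set_eq_iff)
qed

lemma topspace_M: "topspace (M_topology L \<Gamma>) = range (coset_M L \<Gamma>)"
  using quotient_imp_surjective_map[OF quotient_map_coset_M] by auto

lemma topspace_SM: "topspace (SM_topology L \<Gamma>) = range (coset_M L \<Gamma>) \<times> sphere 0 1"
  by (simp add: SM_topology_def topspace_M)

text \<open>The exponentials of the lattice coordinates together with u separate exactly the cosets,
  so they induce a continuous injection of M into a Hausdorff space.\<close>

lemma Hausdorff_space_M: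
  assumes "linear L"
  shows "Hausdorff_space (M_topology L \<Gamma>)"
proof -
  define h :: "'a \<times> real \<Rightarrow> (nat \<Rightarrow> complex) \<times> real"
    \<comment> \<open>The value 1 for indices from \<open>n\<close> on is a continuous filler: the
      target consists of functions on all naturals.\<close>
    where "h = (\<lambda>g. (\<lambda>i. if i < n then cis (2 * pi * co i (fst g)) else 1, snd g))"
  have h_eq: "h g = h g' \<longleftrightarrow> coset_M L \<Gamma> g = coset_M L \<Gamma> g'" for g g'
  proof -
    obtain w u w' u' where g: "g = (w, u)" "g' = (w', u')" by force
    have "(2 * pi * co i w - 2 * pi * co i w') / (2 * pi) = co i w - co i w'" for i
      by (simp add: field_simps)
    then have "cis (2 * pi * co i w) = cis (2 * pi * co i w') \<longleftrightarrow> co i w - co i w' \<in> \<int>" for i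
      by (simp add: cis_eq_iff)
    moreover have "h g = h g' \<longleftrightarrow> (\<forall>i<n. cis (2 * pi * co i w) = cis (2 * pi * co i w')) \<and> u = u'"
      by (auto simp: h_def g fun_eq_iff)
    ultimately show ?thesis
      by (auto simp: g coset_M_eq_iff[OF assms])
  qed
  have "continuous_on UNIV (\<lambda>g. cis (2 * pi * co i (fst g)))" for i
  proof -
    have "continuous_on UNIV (co i)"
      using linear_co by (simp add: linear_continuous_on linear_conv_bounded_linear)
    then have "continuous_on UNIV (\<lambda>g. co i (fst g))"
      by (rule continuous_on_compose2[OF _ continuous_on_fst[OF continuous_on_id] subset_UNIV])
    then show ?thesis
      by (intro continuous_on_cis continuous_on_mult_left)
  qed
  then have "continuous_on UNIV (\<lambda>g. if i < n then cis (2 * pi * co i (fst g)) else 1)" for i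
    by (cases "i < n") auto
  then have "continuous_on UNIV h"
    unfolding h_def
    by (intro continuous_on_Pair[OF continuous_on_coordinatewise_then_product
        continuous_on_snd[OF continuous_on_id]])
  then have "continuous_map euclidean euclidean h" by simp
  with quotient_map_coset_M
  obtain f where f: "continuous_map (M_topology L \<Gamma>) euclidean f" "\<And>g. f (coset_M L \<Gamma> g) = h g"
    by (rule quotient_map_lift_exists) (auto simp: h_eq)
  have "inj_on f (topspace (M_topology L \<Gamma>))"
    by (auto simp: topspace_M inj_on_def f h_eq)
  from Hausdorff_space_injective_preimage[OF Hausdorff_space_euclidean f(1) this] show ?thesis .
qed

lemma Hausdorff_space_SM: "linear L \<Longrightarrow> Hausdorff_space (SM_topology L \<Gamma>)"
  by (simp add: SM_topology_def Hausdorff_space_prod_topology Hausdorff_space_M Hausdorff_space_subtopology)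

end


section \<open>Invariant tori\<close>

lemma constant_on_reals:
  fixes d :: "real \<Rightarrow> 'a::real_inner"
  assumes "\<And>t. (d has_vector_derivative 0) (at t)"
  shows "d t = d 0"
  by (rule constant_on_segment) (rule has_vector_derivative_at_within[OF assms])

lemma has_vector_derivative_shift:
  assumes "\<And>t. (f has_vector_derivative f' t) (at t)"
  shows "((\<lambda>t. f (t + a)) has_vector_derivative f' (t + a)) (at t)"
proof -
  have "((\<lambda>t. t + a) has_vector_derivative 1) (at t)"
    by (auto intro!: derivative_eq_intros)
  from vector_diff_chain_at[OF this assms] show ?thesis by (simp add: o_def)
qed

lemma has_vector_derivative_reflect:
  assumes "\<And>t. (f has_vector_derivative f' t) (at t)"
  shows "((\<lambda>t. f (a - t)) has_vector_derivative - f' (a - t)) (at t)"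
proof -
  have "((\<lambda>t. a - t) has_vector_derivative -1) (at t)"
    by (auto intro!: derivative_eq_intros)
  from vector_diff_chain_at[OF this assms] show ?thesis by (simp add: o_def)
qed

lemma LF_field_eq:
  "LF_field L F ((w, u), x) = ((exp_op L u (fst x), snd x), sphere_field F x)"
  by (cases x) (simp add: sphere_field_def)

text \<open>The system is triangular: the sphere components agree by uniqueness there, then u has
  the same derivative and start, then w has the same derivative. The starts in w may differ, because
  two lifts of one point of SM differ by a lattice translation.\<close>

lemma LF_solution_unique:
  fixes F L :: "'a::euclidean_space \<Rightarrow> 'a"
  assumes lip: "K-lipschitz_on (cball 0 1) F"
    and \<rho>: "\<And>s. \<rho> s \<in> UNIV \<times> sphere 0 1" "\<And>s. (\<rho> has_vector_derivative LF_field L F (\<rho> s)) (at s)"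
    and \<sigma>: "\<And>s. s \<in> closed_segment 0 t \<Longrightarrow> snd (\<sigma> s) \<in> sphere 0 1 \<and>
              (\<sigma> has_vector_derivative LF_field L F (\<sigma> s)) (at s within closed_segment 0 t)"
    and init: "snd (\<sigma> 0) = snd (\<rho> 0)" "snd (fst (\<sigma> 0)) = snd (fst (\<rho> 0))"
  shows "\<sigma> t = \<rho> t + ((fst (fst (\<sigma> 0)) - fst (fst (\<rho> 0)), 0), 0)"
proof -
  let ?w = "\<lambda>\<tau>. fst (fst \<tau>)" and ?u = "\<lambda>\<tau>. snd (fst \<tau>)"
  have sub: "closed_segment 0 r \<subseteq> closed_segment 0 t" if "r \<in> closed_segment 0 t" for r
    using that by (meson ends_in_segment(1) subset_closed_segment)
  have field: "LF_field L F \<tau> = ((exp_op L (?u \<tau>) (fst (snd \<tau>)), snd (snd \<tau>)), sphere_field F (snd \<tau>))" for \<tau>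
    by (metis LF_field_eq prod.collapse)
  have parts: "((\<lambda>s. snd (\<tau> s)) has_vector_derivative sphere_field F (snd (\<tau> s))) (at s within S)"
    "((\<lambda>s. ?u (\<tau> s)) has_vector_derivative snd (snd (\<tau> s))) (at s within S)"
    "((\<lambda>s. ?w (\<tau> s)) has_vector_derivative exp_op L (?u (\<tau> s)) (fst (snd (\<tau> s)))) (at s within S)"
    if "(\<tau> has_vector_derivative LF_field L F (\<tau> s)) (at s within S)" for \<tau> s S
  proof -
    note D = that[unfolded has_vector_derivative_def]
    note Df = has_derivative_fst[OF D]
    show "((\<lambda>s. snd (\<tau> s)) has_vector_derivative sphere_field F (snd (\<tau> s))) (at s within S)"
      using has_derivative_snd[OF D] by (simp add: has_vector_derivative_def field)
    show "((\<lambda>s. ?u (\<tau> s)) has_vector_derivative snd (snd (\<tau> s))) (at s within S)"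
      using has_derivative_snd[OF Df] by (simp add: has_vector_derivative_def field)
    show "((\<lambda>s. ?w (\<tau> s)) has_vector_derivative exp_op L (?u (\<tau> s)) (fst (snd (\<tau> s)))) (at s within S)"
      using has_derivative_fst[OF Df] by (simp add: has_vector_derivative_def field)
  qed
  have motion: "sphere_motion F (\<lambda>s. snd (\<rho> s))"
    unfolding sphere_motion_def using \<rho>(1) parts(1)[OF \<rho>(2)] by (auto simp: mem_Times_iff)
  have snd_eq: "snd (\<sigma> r) = snd (\<rho> r)" if r: "r \<in> closed_segment 0 t" for r
  proof -
    have "snd (\<rho> r) = snd (\<sigma> r)"
    proof (rule sphere_solution_unique[OF lip motion])
      fix s assume "s \<in> closed_segment 0 r"
      with sub[OF r] have s: "s \<in> closed_segment 0 t" by blast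
      show "snd (\<sigma> s) \<in> sphere 0 1 \<and>
         ((\<lambda>s. snd (\<sigma> s)) has_vector_derivative sphere_field F (snd (\<sigma> s))) (at s within closed_segment 0 r)"
        using \<sigma>[OF s] has_vector_derivative_within_subset[OF parts(1) sub[OF r]] by blast
    qed (simp add: init)
    then show ?thesis ..
  qed
  have u_eq: "?u (\<sigma> r) = ?u (\<rho> r)" if r: "r \<in> closed_segment 0 t" for r
  proof -
    have "?u (\<sigma> r) - ?u (\<rho> r) = ?u (\<sigma> 0) - ?u (\<rho> 0)"
    proof (rule constant_on_segment[of r "\<lambda>s. ?u (\<sigma> s) - ?u (\<rho> s)"])
      fix s assume "s \<in> closed_segment 0 r"
      with sub[OF r] have s: "s \<in> closed_segment 0 t" by blast
      have "((\<lambda>s. ?u (\<sigma> s)) has_vector_derivative snd (snd (\<sigma> s))) (at s within closed_segment 0 r)"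
        using \<sigma>[OF s] has_vector_derivative_within_subset[OF parts(2) sub[OF r]] by blast
      from has_vector_derivative_diff[OF this has_vector_derivative_at_within[OF parts(2)[OF \<rho>(2)]]]
      show "((\<lambda>s. ?u (\<sigma> s) - ?u (\<rho> s)) has_vector_derivative 0) (at s within closed_segment 0 r)"
        by (simp add: snd_eq[OF s])
    qed
    then show ?thesis by (simp add: init)
  qed
  have "?w (\<sigma> t) - ?w (\<rho> t) = ?w (\<sigma> 0) - ?w (\<rho> 0)"
  proof (rule constant_on_segment[of t "\<lambda>s. ?w (\<sigma> s) - ?w (\<rho> s)"])
    fix s assume s: "s \<in> closed_segment 0 t"
    from \<sigma>[OF s] has_vector_derivative_diff[OF parts(3) has_vector_derivative_at_within[OF parts(3)[OF \<rho>(2)]]]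
    have "((\<lambda>s. ?w (\<sigma> s) - ?w (\<rho> s)) has_vector_derivative
      exp_op L (?u (\<sigma> s)) (fst (snd (\<sigma> s))) - exp_op L (?u (\<rho> s)) (fst (snd (\<rho> s)))) (at s within closed_segment 0 t)"
      by blast
    then show "((\<lambda>s. ?w (\<sigma> s) - ?w (\<rho> s)) has_vector_derivative 0) (at s within closed_segment 0 t)"
      by (simp add: snd_eq[OF s] u_eq[OF s])
  qed
  with snd_eq[of t] u_eq[of t] show ?thesis by (simp add: prod_eq_iff algebra_simps)
qed

lemma Ck_curve_ident: "Ck_curve k (\<lambda>t. t)"
proof (rule Ck_curve_pred, rule Ck_curve_SucI)
  show "((\<lambda>t. t) has_vector_derivative 1) (at t)" for t :: real
    by (auto intro!: derivative_eq_intros)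
qed (rule Ck_curve_const)

locale bouncing_motion = lattice_coords \<Gamma> n b co
  for \<Gamma> :: "'a::euclidean_space set" and n b co +
  fixes L F :: "'a \<Rightarrow> 'a" and K :: real
    and x :: "real \<Rightarrow> 'a \<times> real" and u :: "real \<Rightarrow> real" and w :: "real \<Rightarrow> 'a"
    and \<alpha> \<beta> :: real
  assumes L: "linear L" and smooth: "smooth_on (cball 0 1) F" and lip: "K-lipschitz_on (cball 0 1) F"
    and motion: "sphere_motion F x" and bounce: "bounce x \<alpha> \<beta>"
    and u_der: "\<And>t. (u has_vector_derivative snd (x t)) (at t)"
    and w_der: "\<And>t. (w has_vector_derivative exp_op L (u t) (fst (x t))) (at t)"
begin

definition "T = 2 * (\<beta> - \<alpha>)"

lemma T_pos: "T > 0"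
  using bounce by (simp add: T_def bounce_def)

lemma x_periodic: "x (t + T) = x t"
  unfolding T_def by (rule bounce_periodic[OF lip motion bounce])

text \<open>\<eta> is odd about \<open>a\<close>, hence its antiderivative is even about
  \<open>a\<close>.\<close>

lemma u_reflect:
  assumes "snd (x a) = 0"
  shows "u (a + t) = u (a - t)"
proof -
  have "u (t + a) - u (a - t) = u (0 + a) - u (a - 0)"
  proof (rule constant_on_reals[of "\<lambda>t. u (t + a) - u (a - t)"])
    fix t
    have "snd (x (t + a)) = - snd (x (a - t))"
      using sphere_motion_reflect[OF lip motion assms, of t] by (simp add: flip_def add.commute)
    then show "((\<lambda>t. u (t + a) - u (a - t)) has_vector_derivative 0) (at t)"
      using has_vector_derivative_diff[OF has_vector_derivative_shift[OF u_der, of a t]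
        has_vector_derivative_reflect[OF u_der, of a t]] by simp
  qed
  then show ?thesis by (simp add: add.commute)
qed

lemma u_periodic: "u (t + T) = u t"
proof -
  have z: "snd (x \<alpha>) = 0" "snd (x \<beta>) = 0" using bounce by (auto simp: bounce_def)
  have "u (t + T) = u (\<alpha> + (\<alpha> - t))"
    using u_reflect[OF z(2), of "t + \<beta> - 2 * \<alpha>"] by (simp add: T_def algebra_simps)
  also have "\<dots> = u t"
    using u_reflect[OF z(1), of "\<alpha> - t"] by simp
  finally show ?thesis .
qed

definition "\<Delta> = w T - w 0"

definition "g t = w t - (t / T) *\<^sub>R \<Delta>"

text \<open>Periodicity of u and x makes the derivative of w periodic, so w gains the same \<Delta>
  in every period, which the linear term takes away.\<close>

lemma g_periodic: "g (t + T) = g t"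
proof -
  have "w (t + T) - w t = w (0 + T) - w 0"
  proof (rule constant_on_reals[of "\<lambda>t. w (t + T) - w t"])
    show "((\<lambda>t. w (t + T) - w t) has_vector_derivative 0) (at t)" for t
      using has_vector_derivative_diff[OF has_vector_derivative_shift[OF w_der, of T t] w_der[of t]]
      by (simp add: x_periodic u_periodic)
  qed
  then have "w (t + T) = w t + \<Delta>" by (simp add: \<Delta>_def algebra_simps)
  then show ?thesis using T_pos by (simp add: g_def add_divide_distrib scaleR_left_distrib)
qed

definition "c t = ((g t, u t), x t)"

lemma c_periodic_int: "c (t + of_int m * T) = c t"
proof -
  interpret periodic_fun_simple c T
    by standard (simp add: c_def g_periodic u_periodic x_periodic)
  show ?thesis by (rule plus_of_int)
qed

text \<open>The sphere component alone has minimal period T; injectivity in the last angle rests on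
  this.\<close>

lemma c_eqD: "snd (c s) = snd (c t) \<Longrightarrow> \<exists>m::int. t - s = of_int m * T"
  unfolding T_def c_def using bounce_minimal_period[OF lip motion bounce] by simp

lemma c_has_vector_derivative:
  "(c has_vector_derivative ((exp_op L (u t) (fst (x t)) - (1 / T) *\<^sub>R \<Delta>, snd (x t)), sphere_field F (x t))) (at t)"
proof -
  have "((\<lambda>t. (t / T) *\<^sub>R \<Delta>) has_vector_derivative (1 / T) *\<^sub>R \<Delta>) (at t)"
    using T_pos unfolding has_vector_derivative_def by (auto intro!: derivative_eq_intros)
  from has_vector_derivative_diff[OF w_der this]
  have "(g has_vector_derivative exp_op L (u t) (fst (x t)) - (1 / T) *\<^sub>R \<Delta>) (at t)"
    by (simp add: g_def[abs_def])
  moreover have "(x has_vector_derivative sphere_field F (x t)) (at t)"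
    using motion by (simp add: sphere_motion_def)
  ultimately show ?thesis
    unfolding c_def[abs_def] by (intro has_vector_derivative_Pair u_der)
qed

lemma Ck_curve_c: "Ck_curve k c"
proof -
  have x: "Ck_curve k x" for k by (rule Ck_curve_sphere_motion[OF smooth motion])
  have u: "Ck_curve k u" for k
    by (rule Ck_curve_pred[OF Ck_curve_SucI[OF u_der Ck_curve_snd[OF x]]])
  have w: "Ck_curve k w" for k
    by (rule Ck_curve_pred[OF Ck_curve_SucI[OF w_der Ck_curve_exp_op[OF L u Ck_curve_fst[OF x]]]])
  have "Ck_curve k (\<lambda>t. t *\<^sub>R (- ((1 / T) *\<^sub>R \<Delta>)))" for k
    by (intro Ck_curve_scaleR Ck_curve_ident Ck_curve_const)
  from Ck_curve_add[OF w this] have "Ck_curve k g" for k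
    by (simp add: g_def[abs_def])
  with x u show ?thesis unfolding c_def[abs_def] by (intro Ck_curve_Pair)
qed

section \<open>The torus in angle coordinates\<close>

definition "\<kappa> r = c (r * (T / (2 * pi)))"

text \<open>Scaled so that increasing the angle j by 2 pi translates by the lattice vector
  \<open>b j\<close>.\<close>

definition "v j = (((1 / (2 * pi)) *\<^sub>R b j, 0 :: real), 0 :: 'a \<times> real)"

definition "\<Psi> \<theta> = (\<Sum>j<n. \<theta> j *\<^sub>R v j) + \<kappa> (\<theta> n)"

lemma \<Psi>_eq: "\<Psi> \<theta> = (((\<Sum>j<n. (\<theta> j / (2 * pi)) *\<^sub>R b j) + g (\<theta> n * (T / (2 * pi))), u (\<theta> n * (T / (2 * pi)))),
                   x (\<theta> n * (T / (2 * pi))))"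
  by (simp add: \<Psi>_def \<kappa>_def v_def c_def prod_eq_iff fst_sum snd_sum)

lemma Ck_curve_\<kappa>: "Ck_curve k \<kappa>"
proof -
  have "Ck_curve k (\<lambda>r. r *\<^sub>R (T / (2 * pi)))"
    by (rule Ck_curve_scaleR[OF Ck_curve_ident Ck_curve_const])
  from Ck_curve_compose[OF Ck_curve_c this] show ?thesis
    by (simp only: \<kappa>_def[abs_def] real_scaleR_def)
qed

lemma C_m_angles_\<Psi>: "C_m_angles (Suc n) m \<Psi>"
  unfolding \<Psi>_def[abs_def] by (rule C_m_angles_curve[OF Ck_curve_\<kappa>])

text \<open>The first n partial derivatives have no component in the sphere direction, where the
  last one is a nonzero multiple of the sphere field. So the last coefficient vanishes, and the
  others do because the \<open>b j\<close> are independent.\<close>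

lemma \<Psi>_immersion:
  assumes "(\<Sum>i<Suc n. a i *\<^sub>R partial_deriv i \<Psi> \<theta>) = 0" "i < Suc n"
  shows "a i = 0"
proof -
  define \<kappa>' where "\<kappa>' r = (T / (2 * pi)) *\<^sub>R
    ((exp_op L (u (r * (T / (2 * pi)))) (fst (x (r * (T / (2 * pi))))) - (1 / T) *\<^sub>R \<Delta>, snd (x (r * (T / (2 * pi))))),
     sphere_field F (x (r * (T / (2 * pi)))))" for r
  have "((\<lambda>r. r * (T / (2 * pi))) has_vector_derivative T / (2 * pi)) (at r)" for r
    unfolding has_vector_derivative_def by (auto intro!: derivative_eq_intros)
  from vector_diff_chain_at[OF this c_has_vector_derivative]
  have "(\<kappa> has_vector_derivative \<kappa>' r) (at r)" for r
    by (simp add: \<kappa>_def[abs_def] \<kappa>'_def o_def)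
  from partial_deriv_angle[OF _ this, of _ n v]
  have pd: "partial_deriv i \<Psi> \<theta> = (if i < n then v i else \<kappa>' (\<theta> n))" if "i \<le> n" for i
    using that by (simp add: \<Psi>_def[abs_def])
  have "(\<Sum>i<Suc n. a i *\<^sub>R partial_deriv i \<Psi> \<theta>) = (\<Sum>i<n. a i *\<^sub>R v i) + a n *\<^sub>R \<kappa>' (\<theta> n)"
    by (simp add: pd)
  with assms have sum0: "(\<Sum>i<n. a i *\<^sub>R v i) + a n *\<^sub>R \<kappa>' (\<theta> n) = 0" by simp
  have "snd ((\<Sum>i<n. a i *\<^sub>R v i) + a n *\<^sub>R \<kappa>' (\<theta> n)) = a n *\<^sub>R snd (\<kappa>' (\<theta> n))"
    by (simp add: snd_sum v_def)
  then have "a n *\<^sub>R snd (\<kappa>' (\<theta> n)) = 0" by (simp add: sum0)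
  moreover have "snd (\<kappa>' (\<theta> n)) \<noteq> 0"
    using sphere_field_nonzero[OF lip motion bounce] T_pos by (simp add: \<kappa>'_def)
  ultimately have an: "a n = 0" by simp
  with sum0 have "(\<Sum>i<n. a i *\<^sub>R v i) = 0" by simp
  moreover have "(\<Sum>i<n. (a i / (2 * pi)) *\<^sub>R b i) = fst (fst (\<Sum>i<n. a i *\<^sub>R v i))"
    by (simp add: fst_sum v_def)
  ultimately have "(\<Sum>i<n. (a i / (2 * pi)) *\<^sub>R b i) = 0"
    by simp
  then have "a j / (2 * pi) = 0" if "j < n" for j
    using co_combination[OF that, of "\<lambda>i. a i / (2 * pi)"] linear_0[OF linear_co] by simp
  with an assms(2) show ?thesis by (cases "i = n") auto
qed

lemma proj_TM_eq: "proj_TM L \<Gamma> ((p, r), y) = (coset_M L \<Gamma> (p, r), y)"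
  by (simp add: proj_TM_def)

text \<open>Equality of the sphere components already fixes the phase modulo T, so the periodic
  parts coincide, and the cosets then compare only the first n angles.\<close>

lemma proj_\<Psi>_eq_iff:
  "proj_TM L \<Gamma> (\<Psi> \<theta>) = proj_TM L \<Gamma> (\<Psi> \<theta>') \<longleftrightarrow> torus_angle (Suc n) \<theta> = torus_angle (Suc n) \<theta>'"
proof -
  define \<tau> \<tau>' where "\<tau> = \<theta> n * (T / (2 * pi))" and "\<tau>' = \<theta>' n * (T / (2 * pi))"
  have co_eq: "co i ((\<Sum>j<n. (\<theta> j / (2 * pi)) *\<^sub>R b j) + p) - co i ((\<Sum>j<n. (\<theta>' j / (2 * pi)) *\<^sub>R b j) + p)
     = (\<theta> i - \<theta>' i) / (2 * pi)" if "i < n" for i p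
    using that by (simp add: linear_add[OF linear_co] co_combination diff_divide_distrib)
  have per: "(\<theta> n - \<theta>' n) / (2 * pi) \<in> \<int> \<longleftrightarrow> c \<tau> = c \<tau>'"
  proof
    assume "(\<theta> n - \<theta>' n) / (2 * pi) \<in> \<int>"
    then obtain m :: int where "(\<theta> n - \<theta>' n) / (2 * pi) = m" by (auto elim: Ints_cases)
    then have "\<tau> = \<tau>' + of_int m * T" by (simp add: \<tau>_def \<tau>'_def field_simps)
    then show "c \<tau> = c \<tau>'" by (simp add: c_periodic_int)
  next
    assume "c \<tau> = c \<tau>'"
    then obtain m :: int where "\<tau> - \<tau>' = of_int m * T" using c_eqD[of \<tau>' \<tau>] by auto
    then have "((\<theta> n - \<theta>' n) / (2 * pi)) * T = of_int m * T"
      by (simp add: \<tau>_def \<tau>'_def field_simps)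
    then have "(\<theta> n - \<theta>' n) / (2 * pi) = of_int m"
      by (rule mult_right_cancel[THEN iffD1, rotated]) (use T_pos in simp)
    then show "(\<theta> n - \<theta>' n) / (2 * pi) \<in> \<int>" by simp
  qed
  have snd_c: "x \<tau> = x \<tau>' \<longleftrightarrow> c \<tau> = c \<tau>'"
  proof
    assume "x \<tau> = x \<tau>'"
    then obtain m :: int where "\<tau> = \<tau>' + of_int m * T" using c_eqD[of \<tau>' \<tau>] by (auto simp: c_def algebra_simps)
    then show "c \<tau> = c \<tau>'" by (simp add: c_periodic_int)
  qed (simp add: c_def)
  have "proj_TM L \<Gamma> (\<Psi> \<theta>) = proj_TM L \<Gamma> (\<Psi> \<theta>') \<longleftrightarrow>
     c \<tau> = c \<tau>' \<and> (\<forall>i<n. (\<theta> i - \<theta>' i) / (2 * pi) \<in> \<int>)"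
  proof (cases "c \<tau> = c \<tau>'")
    case True
    then have "g \<tau> = g \<tau>'" "u \<tau> = u \<tau>'" "x \<tau> = x \<tau>'" by (auto simp: c_def)
    with True co_eq[of _ "g \<tau>'"] show ?thesis
      unfolding \<Psi>_eq \<tau>_def[symmetric] \<tau>'_def[symmetric] proj_TM_eq
      by (simp add: coset_M_eq_iff[OF L])
  next
    case False
    then show ?thesis
      unfolding \<Psi>_eq \<tau>_def[symmetric] \<tau>'_def[symmetric] proj_TM_eq by (simp add: snd_c)
  qed
  then show ?thesis
    unfolding torus_angle_eq_iff per[symmetric] by (auto simp: less_Suc_eq)
qed

text \<open>\<open>Arg\<close> picks one choice of angles; the value is independent of it by
  \<open>proj_\<Psi>_eq_iff\<close>.\<close>

definition "\<Phi> z = proj_TM L \<Gamma> (\<Psi> (\<lambda>i. Arg (z i)))"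

lemma \<Phi>_torus_angle: "\<Phi> (torus_angle (Suc n) \<theta>) = proj_TM L \<Gamma> (\<Psi> \<theta>)"
  unfolding \<Phi>_def proj_\<Psi>_eq_iff by (rule torus_angle_Arg[OF torus_angle_in_torus])

lemma continuous_\<Psi>: "continuous_on S \<Psi>"
  using C_m_angles_\<Psi>[of 0] continuous_on_subset[OF _ subset_UNIV] by simp

lemma \<Psi>_sphere: "snd (\<Psi> \<theta>) \<in> sphere 0 1"
  using motion by (simp add: \<Psi>_eq sphere_motion_def)

lemma continuous_map_proj_\<Psi>:
  "continuous_map (top_of_set S) (SM_topology L \<Gamma>) (\<lambda>\<theta>. proj_TM L \<Gamma> (\<Psi> \<theta>))"
  unfolding SM_topology_def continuous_map_pairwise
proof
  have "continuous_map (top_of_set S) euclidean (\<lambda>\<theta>. fst (\<Psi> \<theta>))"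
    by (simp add: continuous_on_fst continuous_\<Psi>)
  from continuous_map_compose[OF this quotient_imp_continuous_map[OF quotient_map_coset_M]]
  show "continuous_map (top_of_set S) (M_topology L \<Gamma>) (fst \<circ> (\<lambda>\<theta>. proj_TM L \<Gamma> (\<Psi> \<theta>)))"
    by (simp add: o_def proj_TM_def)
  have "continuous_map (top_of_set S) (top_of_set (sphere 0 1)) (\<lambda>\<theta>. snd (\<Psi> \<theta>))"
    using \<Psi>_sphere by (auto simp: continuous_map_in_subtopology intro: continuous_on_snd continuous_\<Psi>)
  then show "continuous_map (top_of_set S) (top_of_set (sphere 0 1)) (snd \<circ> (\<lambda>\<theta>. proj_TM L \<Gamma> (\<Psi> \<theta>)))"
    by (simp add: o_def proj_TM_def)
qed

text \<open>A continuous injection of a compact space into a Hausdorff space is an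
  embedding.\<close>

lemma embedding_\<Phi>: "embedding_map (torus (Suc n)) (SM_topology L \<Gamma>) \<Phi>"
proof (rule continuous_imp_embedding_map)
  show "continuous_map (torus (Suc n)) (SM_topology L \<Gamma>) \<Phi>"
    by (rule continuous_compose_quotient_map[OF quotient_map_torus_angle])
       (simp add: o_def \<Phi>_torus_angle continuous_map_proj_\<Psi>)
  show "inj_on \<Phi> (topspace (torus (Suc n)))"
  proof (rule inj_onI)
    fix z z' assume z: "z \<in> topspace (torus (Suc n))" "z' \<in> topspace (torus (Suc n))" "\<Phi> z = \<Phi> z'"
    then show "z = z'"
      unfolding \<Phi>_def proj_\<Psi>_eq_iff by (simp add: torus_angle_Arg)
  qed
qed (rule compact_space_torus Hausdorff_space_SM[OF L])+

lemma smooth_torus_embedding_\<Phi>: "smooth_torus_embedding L \<Gamma> (Suc n) \<Phi>"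
  unfolding smooth_torus_embedding_def
proof (intro conjI exI[of _ \<Psi>] allI impI)
  show "a i = 0" if "(\<Sum>i<Suc n. a i *\<^sub>R partial_deriv i \<Psi> \<theta>) = 0" "i < Suc n" for \<theta> a i
    using that by (rule \<Psi>_immersion)
qed (rule embedding_\<Phi> \<Phi>_torus_angle C_m_angles_\<Psi>)+

text \<open>In one period T the phase turns once, and the angle i advances by 2 pi times the i-th
  lattice coordinate of the drift \<Delta>.\<close>

definition "\<omega> i = (if i < n then 2 * pi * co i \<Delta> / T else 2 * pi / T)"

text \<open>The advance of the first n angles restores the drift that \<open>g\<close> has
  subtracted, so w itself reappears, shifted in time and translated by a constant.\<close>

lemma \<Psi>_flow:
  "\<Psi> (\<lambda>i. \<theta> i + t * \<omega> i) =
     (((\<Sum>j<n. (\<theta> j / (2 * pi)) *\<^sub>R b j) - (\<theta> n / (2 * pi)) *\<^sub>R \<Delta> + w (t + \<theta> n * (T / (2 * pi))),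
       u (t + \<theta> n * (T / (2 * pi)))), x (t + \<theta> n * (T / (2 * pi))))"
proof -
  have "t * (2 * pi / T) * (T / (2 * pi)) = t"
    using T_pos by simp
  then have "(\<theta> n + t * \<omega> n) * (T / (2 * pi)) = t + \<theta> n * (T / (2 * pi))"
    by (simp only: \<omega>_def distrib_right less_irrefl if_False)
  moreover have "(\<Sum>j<n. ((\<theta> j + t * \<omega> j) / (2 * pi)) *\<^sub>R b j)
      = (\<Sum>j<n. (\<theta> j / (2 * pi)) *\<^sub>R b j + (t / T) *\<^sub>R (co j \<Delta> *\<^sub>R b j))"
  proof (intro sum.cong refl)
    fix j assume "j \<in> {..<n}"
    then have "(\<theta> j + t * \<omega> j) / (2 * pi) = \<theta> j / (2 * pi) + t / T * co j \<Delta>"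
      by (simp add: \<omega>_def add_divide_distrib)
    then show "((\<theta> j + t * \<omega> j) / (2 * pi)) *\<^sub>R b j = (\<theta> j / (2 * pi)) *\<^sub>R b j + (t / T) *\<^sub>R (co j \<Delta> *\<^sub>R b j)"
      by (simp only: scaleR_left_distrib scaleR_scaleR)
  qed
  then have "(\<Sum>j<n. ((\<theta> j + t * \<omega> j) / (2 * pi)) *\<^sub>R b j)
      = (\<Sum>j<n. (\<theta> j / (2 * pi)) *\<^sub>R b j) + (t / T) *\<^sub>R \<Delta>"
    by (simp only: sum.distrib scaleR_sum_right[symmetric] expansion)
  moreover have "g (t + \<theta> n * (T / (2 * pi))) = w (t + \<theta> n * (T / (2 * pi))) - (t / T) *\<^sub>R \<Delta> - (\<theta> n / (2 * pi)) *\<^sub>R \<Delta>"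
  proof -
    have "(t + \<theta> n * (T / (2 * pi))) / T = t / T + \<theta> n / (2 * pi)"
      using T_pos by (simp add: field_simps)
    then show ?thesis by (simp only: g_def scaleR_left_distrib diff_diff_eq)
  qed
  ultimately show ?thesis
    unfolding \<Psi>_eq by (simp only: prod.inject) simp
qed

text \<open>Time shifts and translations in w preserve solutions, as the field depends neither on
  time nor on w.\<close>

lemma \<Psi>_flow_solution:
  "((\<lambda>t. \<Psi> (\<lambda>i. \<theta> i + t * \<omega> i)) has_vector_derivative LF_field L F (\<Psi> (\<lambda>i. \<theta> i + t * \<omega> i))) (at t)"
proof -
  have x_der: "(x has_vector_derivative sphere_field F (x t)) (at t)" for t
    using motion by (simp add: sphere_motion_def)
  have add_const: "((\<lambda>t. p + f t) has_vector_derivative f') (at t)"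
    if "(f has_vector_derivative f') (at t)" for f :: "real \<Rightarrow> 'a" and f' p
    using has_vector_derivative_add[OF has_vector_derivative_const that] by simp
  show ?thesis
    unfolding \<Psi>_flow LF_field_eq
    by (intro has_vector_derivative_Pair add_const has_vector_derivative_shift[OF u_der]
        has_vector_derivative_shift[OF x_der] has_vector_derivative_shift[OF w_der])
qed

text \<open>A competing lifted motion may start at a lift that differs from \<open>\<rho> 0\<close>
  by a lattice translation; this translation persists in time and disappears in the
  quotient.\<close>

lemma LF_flow_\<Phi>:
  assumes "z \<in> topspace (torus (Suc n))"
  shows "LF_flow L F \<Gamma> t (\<Phi> z) y \<longleftrightarrow> y = \<Phi> (linear_flow (Suc n) \<omega> t z)"
proof -
  define \<theta> where "\<theta> = (\<lambda>i. Arg (z i))"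
  have z: "z = torus_angle (Suc n) \<theta>" using torus_angle_Arg[OF assms] by (simp add: \<theta>_def)
  define \<rho> where "\<rho> t = \<Psi> (\<lambda>i. \<theta> i + t * \<omega> i)" for t
  have \<rho>0: "\<rho> 0 = \<Psi> \<theta>" by (simp add: \<rho>_def)
  have \<Phi>z: "\<Phi> z = proj_TM L \<Gamma> (\<rho> 0)" by (simp add: z \<Phi>_torus_angle \<rho>0)
  have \<Phi>t: "\<Phi> (linear_flow (Suc n) \<omega> t z) = proj_TM L \<Gamma> (\<rho> t)"
    by (simp add: z linear_flow_torus_angle \<Phi>_torus_angle \<rho>_def)
  have \<rho>_sphere: "snd (\<rho> s) \<in> sphere 0 1" for s unfolding \<rho>_def by (rule \<Psi>_sphere)
  have \<rho>_der: "(\<rho> has_vector_derivative LF_field L F (\<rho> s)) (at s)" for s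
    unfolding \<rho>_def by (rule \<Psi>_flow_solution)
  show ?thesis
    unfolding \<Phi>t
  proof
    assume "y = proj_TM L \<Gamma> (\<rho> t)"
    then show "LF_flow L F \<Gamma> t (\<Phi> z) y"
      unfolding LF_flow_def \<Phi>z using \<rho>_sphere \<rho>_der by (blast intro: has_vector_derivative_at_within)
  next
    assume "LF_flow L F \<Gamma> t (\<Phi> z) y"
    then obtain \<sigma> where \<sigma>: "\<And>s. s \<in> closed_segment 0 t \<Longrightarrow> snd (\<sigma> s) \<in> sphere 0 1 \<and>
          (\<sigma> has_vector_derivative LF_field L F (\<sigma> s)) (at s within closed_segment 0 t)"
      and ends: "proj_TM L \<Gamma> (\<sigma> 0) = proj_TM L \<Gamma> (\<rho> 0)" "proj_TM L \<Gamma> (\<sigma> t) = y"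
      unfolding LF_flow_def \<Phi>z by blast
    obtain p0 r0 y0 where s0: "\<sigma> 0 = ((p0, r0), y0)" by (metis prod.exhaust)
    obtain p1 r1 y1 where q0: "\<rho> 0 = ((p1, r1), y1)" by (metis prod.exhaust)
    have eq: "y0 = y1" "r0 = r1" and int: "\<And>i. i < n \<Longrightarrow> co i p0 - co i p1 \<in> \<int>"
      using ends(1) by (auto simp: s0 q0 proj_TM_eq coset_M_eq_iff[OF L])
    have "\<sigma> t = \<rho> t + ((fst (fst (\<sigma> 0)) - fst (fst (\<rho> 0)), 0), 0)"
      using \<sigma> \<rho>_sphere eq by (intro LF_solution_unique[OF lip _ \<rho>_der]) (auto simp: s0 q0 mem_Times_iff)
    then have st: "\<sigma> t = \<rho> t + ((p0 - p1, 0), 0)" by (simp add: s0 q0)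
    obtain p2 r2 y2 where qt: "\<rho> t = ((p2, r2), y2)" by (metis prod.exhaust)
    show "y = proj_TM L \<Gamma> (\<rho> t)"
      using int unfolding ends(2)[symmetric] st qt
      by (simp add: proj_TM_eq coset_M_eq_iff[OF L] linear_add[OF linear_co] linear_diff[OF linear_co])
  qed
qed

lemma quasi_periodic_torus_\<Phi>: "quasi_periodic_torus L F \<Gamma> (\<Phi> ` topspace (torus (Suc n)))"
  unfolding quasi_periodic_torus_def
  by (intro exI[of _ "Suc n"] exI[of _ \<Phi>] exI[of _ \<omega>] conjI smooth_torus_embedding_\<Phi> refl)
     (auto simp: LF_flow_\<Phi>)

lemma initial_point_in_torus: "(coset_M L \<Gamma> (w 0, u 0), x 0) \<in> \<Phi> ` topspace (torus (Suc n))"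
proof
  show "(coset_M L \<Gamma> (w 0, u 0), x 0) = \<Phi> (torus_angle (Suc n) (\<lambda>_. 0))"
    by (simp add: \<Phi>_torus_angle \<Psi>_eq proj_TM_eq g_def)
qed (rule torus_angle_in_torus)

text \<open>Needed so that the union of the tori does not exceed the open set: the sphere components
  stay on one orbit.\<close>

lemma torus_subset: "\<Phi> ` topspace (torus (Suc n)) \<subseteq> range (coset_M L \<Gamma>) \<times> range x"
  by (auto simp: \<Phi>_def \<Psi>_eq proj_TM_eq)

end

text \<open>Given the sphere motion, u is an antiderivative of \<eta>, and then w is one of the
  exponential applied to \<xi>. Adding \<open>u0\<close> and \<open>w0\<close> makes the torus pass
  through the prescribed point.\<close>

lemma qp_torus_through_point:
  fixes L F :: "'a::euclidean_space \<Rightarrow> 'a"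
  assumes L: "linear L" and \<Gamma>: "full_rank_lattice \<Gamma>" and smooth: "smooth_on (cball 0 1) F"
    and p: "p \<in> oscillating_points F"
  obtains T where "quasi_periodic_torus L F \<Gamma> T" "(coset_M L \<Gamma> (w0, u0), p) \<in> T"
    "T \<subseteq> range (coset_M L \<Gamma>) \<times> oscillating_points F"
proof -
  obtain K where lip: "K-lipschitz_on (cball 0 1) F"
    using smooth_on_imp_lipschitz[OF smooth] by auto
  obtain x where x: "sphere_motion F x" "oscillating x" "x 0 = p"
    using p by (auto simp: oscillating_points_def)
  obtain \<alpha> \<beta> where bounce: "bounce x \<alpha> \<beta>"
    using oscillating_imp_bounce[OF x(1,2)] .
  have Ck_x: "Ck_curve k x" for k
    by (rule Ck_curve_sphere_motion[OF smooth x(1)])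
  have "continuous_on UNIV (\<lambda>t. snd (x t))"
    using Ck_curve_snd[OF Ck_x[of 0]] by simp
  then obtain u where u: "u 0 = 0" "\<And>t. (u has_vector_derivative snd (x t)) (at t)"
    using antiderivative_UNIV by blast
  define u' where "u' t = u0 + u t" for t
  have u': "(u' has_vector_derivative snd (x t)) (at t)" for t
    unfolding u'_def using has_vector_derivative_add[OF has_vector_derivative_const u(2)] by simp
  have "Ck_curve 0 u'"
    by (rule Ck_curve_pred[OF Ck_curve_SucI[OF u' Ck_curve_snd[OF Ck_x]]])
  from Ck_curve_exp_op[OF L this Ck_curve_fst[OF Ck_x]]
  have "continuous_on UNIV (\<lambda>t. exp_op L (u' t) (fst (x t)))" by simp
  then obtain w where w: "w 0 = 0" "\<And>t. (w has_vector_derivative exp_op L (u' t) (fst (x t))) (at t)"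
    using antiderivative_UNIV by blast
  define w' where "w' t = w0 + w t" for t
  have w': "(w' has_vector_derivative exp_op L (u' t) (fst (x t))) (at t)" for t
    unfolding w'_def using has_vector_derivative_add[OF has_vector_derivative_const w(2)] by simp
  obtain n b co where "lattice_coords \<Gamma> n b co"
    using full_rank_lattice_coords[OF \<Gamma>] .
  then interpret bouncing_motion \<Gamma> n b co L F K x u' w' \<alpha> \<beta>
    using L smooth lip x(1) bounce u' w'
    by (simp add: bouncing_motion_def bouncing_motion_axioms_def)
  have "x t \<in> oscillating_points F" for t
    using sphere_motion_shift[OF x(1), of t] oscillating_shift[OF x(2), of t]
    unfolding oscillating_points_def by (intro CollectI exI[of _ "\<lambda>s. x (s + t)"]) simp
  then show thesis
    using quasi_periodic_torus_\<Phi> initial_point_in_torus torus_subset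
    by (intro that[of "\<Phi> ` topspace (torus (Suc n))"]) (auto simp: u'_def w'_def u(1) w(1) x(3))
qed

lemma oscillating_points_filled:
  fixes L F :: "'a::euclidean_space \<Rightarrow> 'a"
  assumes "linear L" "full_rank_lattice \<Gamma>" "smooth_on (cball 0 1) F"
  shows "filled_with_qp_tori L F \<Gamma> (range (coset_M L \<Gamma>) \<times> oscillating_points F)"
proof -
  let ?U = "range (coset_M L \<Gamma>) \<times> oscillating_points F"
  have "?U \<subseteq> \<Union>{T. quasi_periodic_torus L F \<Gamma> T \<and> T \<subseteq> ?U}"
  proof clarify
    fix w0 u0 p assume "p \<in> oscillating_points F"
    from qp_torus_through_point[OF assms this, of w0 u0]
    show "(coset_M L \<Gamma> (w0, u0), p) \<in> \<Union>{T. quasi_periodic_torus L F \<Gamma> T \<and> T \<subseteq> ?U}"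
      by blast
  qed
  then have "?U = \<Union>{T. quasi_periodic_torus L F \<Gamma> T \<and> T \<subseteq> ?U}"
    by blast
  then show ?thesis
    unfolding filled_with_qp_tori_def
    by (intro exI[of _ "{T. quasi_periodic_torus L F \<Gamma> T \<and> T \<subseteq> ?U}"]) auto
qed

theorem theorem6p1:
  fixes L F :: "real ^ 'n \<Rightarrow> real ^ 'n" and \<Gamma>\<^sub>0 :: "(real ^ 'n) set"
  assumes "linear L"
    and "full_rank_lattice \<Gamma>\<^sub>0"
    and "smooth_on (cball 0 1) F"
  shows "((\<exists>\<zeta>\<^sub>0\<in>ball 0 1. escaping F \<zeta>\<^sub>0) \<longrightarrow> LF_semi_integrable L F \<Gamma>\<^sub>0) \<and>
         (ball 0 1 \<subseteq> closure {\<zeta>\<^sub>0 \<in> ball 0 1. escaping F \<zeta>\<^sub>0} \<longrightarrow> LF_integrable L F \<Gamma>\<^sub>0)"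
proof -
  obtain K where lip: "K-lipschitz_on (cball 0 1) F"
    using smooth_on_imp_lipschitz[OF assms(3)] by auto
  obtain n b co where "lattice_coords \<Gamma>\<^sub>0 n b co"
    using full_rank_lattice_coords[OF assms(2)] .
  then interpret lattice_coords \<Gamma>\<^sub>0 n b co .
  \<comment> \<open>The same open set serves both statements; density is the only additional point
    in the second.\<close>
  let ?U = "range (coset_M L \<Gamma>\<^sub>0) \<times> oscillating_points F"
  have "openin (M_topology L \<Gamma>\<^sub>0) (range (coset_M L \<Gamma>\<^sub>0))"
    by (metis openin_topspace topspace_M)
  then have opn: "openin (SM_topology L \<Gamma>\<^sub>0) ?U"
    unfolding SM_topology_def by (simp add: openin_prod_Times_iff openin_oscillating_points[OF lip])
  have nonempty: "?U \<noteq> {}" if "escaping F \<zeta>" for \<zeta>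
    using oscillating_points_nonempty[OF lip that] by auto
  have filled: "filled_with_qp_tori L F \<Gamma>\<^sub>0 ?U"
    by (rule oscillating_points_filled[OF assms])
  show ?thesis
  proof (intro conjI impI)
    assume "\<exists>\<zeta>\<^sub>0\<in>ball 0 1. escaping F \<zeta>\<^sub>0"
    then obtain \<zeta> where "escaping F \<zeta>" by blast
    then show "LF_semi_integrable L F \<Gamma>\<^sub>0"
      unfolding LF_semi_integrable_def by (intro exI[of _ ?U] conjI opn filled nonempty)
  next
    assume dense: "ball 0 1 \<subseteq> closure {\<zeta>\<^sub>0 \<in> ball 0 1. escaping F \<zeta>\<^sub>0}"
    \<comment> \<open>Density yields at least one escaping point, which the nonemptiness clause of
      integrability asks for.\<close>
    have "(0::real^'n) \<in> closure {\<zeta>\<^sub>0 \<in> ball 0 1. escaping F \<zeta>\<^sub>0}"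
      by (rule subsetD[OF dense]) simp
    then obtain \<zeta> where "\<zeta> \<in> {\<zeta>\<^sub>0 \<in> ball 0 1. escaping F \<zeta>\<^sub>0}"
      unfolding closure_approachable using zero_less_one by blast
    then have \<zeta>: "escaping F \<zeta>" by blast
    have "SM_topology L \<Gamma>\<^sub>0 closure_of ?U = topspace (SM_topology L \<Gamma>\<^sub>0)"
    proof -
      have "top_of_set (sphere 0 1) closure_of oscillating_points F = sphere 0 1"
        using oscillating_points_dense[OF lip dense] oscillating_points_subset[OF lip]
        by (auto simp: closure_of_subtopology Int_absorb1)
      then show ?thesis
        unfolding topspace_SM unfolding SM_topology_def closure_of_Times
        by (metis closure_of_topspace topspace_M)
    qed
    then show "LF_integrable L F \<Gamma>\<^sub>0"
      unfolding LF_integrable_def by (intro exI[of _ ?U] conjI opn filled nonempty[OF \<zeta>])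
  qed
qed


end
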